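(* Let $\mathcal A=\mathcal B\ltimes_\eta\mathsf F$ be an $\eta$-extension, and let $\mathcal D,\mathcal Q\subseteq\mathcal A$ be extension-closed classes satisfying $\operatorname{Ext}^2_{\mathcal A}(\mathcal Q,\mathcal D)=0$. Then $\operatorname{App}(\mathcal D,\mathcal Q)$ is extension-closed. If $A\in\mathcal A$ is image-nilpotent and every factor $\mathsf Z(C_r(A))$ in its $\eta$-Loewy filtration belongs to $\operatorname{App}(\mathcal D,\mathcal Q)$, then $A\in\operatorname{App}(\mathcal D,\mathcal Q)$. More precisely, suppose $\ell_\eta(A)=m$ and choose exact sequences $$0\to\mathsf Z(C_r(A))\to D_r^{\circ}\to Q_r^{\circ}\to0,\qquad D_r^{\circ}\in\mathcal D,\quad Q_r^{\circ}\in\mathcal Q,\quad 0\le r<m.$$ Then there is an exact sequence $0\to A\to D_A\to Q_A\to0$ in $\mathcal A$ with filtrations $$0=D_m\subseteq D_{m-1}\subseteq\cdots\subseteq D_0=D_A,\qquad 0=Q_m\subseteq Q_{m-1}\subseteq\cdots\subseteq Q_0=Q_A$$ such that $D_r/D_{r+1}\cong D_r^{\circ}$ and $Q_r/Q_{r+1}\cong Q_r^{\circ}$ for $0\le r<m$.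
   Context: Conventions: abelian categories under consideration (in particular $\mathcal B$ and $\mathcal A$) have enough projective and enough injective objects; subcategories (classes of objects, viewed as full subcategories) are full, additive and closed under isomorphisms. $\operatorname{Ext}^i_{\mathcal A}(\mathcal Q,\mathcal D)=0$ means $\operatorname{Ext}^i_{\mathcal A}(Q,D)=0$ for all $Q\in\mathcal Q$, $D\in\mathcal D$. Let $\mathcal B$ be an abelian category, $\mathsf F:\mathcal B\to\mathcal B$ a covariant right exact additive functor, and $\eta:\mathsf F^2\to\mathsf F$ a natural transformation that is associative, i.e. $\eta\circ\mathsf F\eta=\eta\circ\eta\mathsf F$. The $\eta$-extension $\mathcal A=\mathcal B\ltimes_\eta\mathsf F$ is the category whose objects are pairs $(B,f)$ with $B\in\mathcal B$ and $f:\mathsf F(B)\to B$ satisfying $f\,\mathsf F(f)=f\,\eta_B$, and whose morphisms $(B,f)\to(B',f')$ are morphisms $\alpha:B\to B'$ with $\alpha f=f'\mathsf F(\alpha)$. It is abelian, with exactness detected in $\mathcal B$. Functors: $\mathsf Z:\mathcal B\to\mathcal A$, $\mathsf Z(X)=(X,0)$; $\mathsf C:\mathcal A\to\mathcal B$, $\mathsf C(X,f)=\operatorname{Coker}f$. For $A=(B,f)$ with image factorization $f=i_Aq_A$, $q_A:\mathsf F(B)\twoheadrightarrow\operatorname{Im}f$, $i_A:\operatorname{Im}f\rightarrowtail B$, put $\mathsf I(A)=(\operatorname{Im}f,\,q_A\mathsf F(i_A))\in\mathcal A$, a subobject of $A$ via $i_A$; $\mathsf I^0(A)=A$, $\mathsf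 I^{r+1}(A)=\mathsf I(\mathsf I^r(A))$. The $\eta$-Loewy filtration of $A$ is $A=\mathsf I^0(A)\supseteq\mathsf I(A)\supseteq\mathsf I^2(A)\supseteq\cdots$; its factors are $\mathsf I^r(A)/\mathsf I^{r+1}(A)\cong\mathsf Z(C_r(A))$ with $C_r(A)=\mathsf C(\mathsf I^r(A))$. $A$ is image-nilpotent if $\mathsf I^d(A)=0$ for some $d\ge0$, and $\ell_\eta(A)=\min\{d\ge0\mid\mathsf I^d(A)=0\}$. For classes $\mathcal D,\mathcal Q\subseteq\mathcal A$, $\operatorname{App}(\mathcal D,\mathcal Q)$ is the class of all $A\in\mathcal A$ for which there is a short exact sequence $0\to A\to D\to Q\to0$ with $D\in\mathcal D$, $Q\in\mathcal Q$. *)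

theory Defs
  imports "HOL-Algebra.Elementary_Groups"
begin

section \<open>Abelian categories\<close>

text \<open>
  Hom-sets are indexed by source and target and are not required to be disjoint: a morphism
  \<open>f\<close> may lie in \<open>mor X Y\<close> for several pairs \<open>(X, Y)\<close>. This lets an \<open>\<eta>\<close>-extension use the
  morphisms of the base category as its own morphisms. The operations \<open>\<cdot>\<close> and \<open>addm\<close>
  are only meaningful on composable, respectively parallel, morphisms between objects.
\<close>

record ('o, 'm) cat =
  obj :: "'o set"
  mor :: "'o \<Rightarrow> 'o \<Rightarrow> 'm set"
  cmp :: "'m \<Rightarrow> 'm \<Rightarrow> 'm"  (infixl \<open>\<cdot>\<index>\<close> 70)
  idm :: "'o \<Rightarrow> 'm"
  addm :: "'m \<Rightarrow> 'm \<Rightarrow> 'm"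
  zerom :: "'o \<Rightarrow> 'o \<Rightarrow> 'm"

definition hom_group :: "('o, 'm) cat \<Rightarrow> 'o \<Rightarrow> 'o \<Rightarrow> 'm monoid" where
  "hom_group C X Y = \<lparr>carrier = mor C X Y, mult = addm C, one = zerom C X Y\<rparr>"

locale category =
  fixes C :: "('o, 'm) cat" (structure)
  assumes cmp_closed:
      "\<lbrakk>X \<in> obj C; Y \<in> obj C; Z \<in> obj C; f \<in> mor C X Y; g \<in> mor C Y Z\<rbrakk> \<Longrightarrow> g \<cdot> f \<in> mor C X Z"
    and idm_closed: "X \<in> obj C \<Longrightarrow> idm C X \<in> mor C X X"
    and cmp_assoc:
      "\<lbrakk>W \<in> obj C; X \<in> obj C; Y \<in> obj C; Z \<in> obj C; f \<in> mor C W X; g \<in> mor C X Y; h \<in> mor C Y Z\<rbrakk>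
        \<Longrightarrow> h \<cdot> (g \<cdot> f) = (h \<cdot> g) \<cdot> f"
    and idm_right: "\<lbrakk>X \<in> obj C; Y \<in> obj C; f \<in> mor C X Y\<rbrakk> \<Longrightarrow> f \<cdot> idm C X = f"
    and idm_left: "\<lbrakk>X \<in> obj C; Y \<in> obj C; f \<in> mor C X Y\<rbrakk> \<Longrightarrow> idm C Y \<cdot> f = f"

locale preadditive_category = category +
  assumes hom_comm_group: "\<lbrakk>X \<in> obj C; Y \<in> obj C\<rbrakk> \<Longrightarrow> comm_group (hom_group C X Y)"
    and cmp_add_right:
      "\<lbrakk>X \<in> obj C; Y \<in> obj C; Z \<in> obj C; f \<in> mor C X Y; f' \<in> mor C X Y; g \<in> mor C Y Z\<rbrakk>
        \<Longrightarrow> g \<cdot> addm C f f' = addm C (g \<cdot> f) (g \<cdot> f')"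
    and cmp_add_left:
      "\<lbrakk>X \<in> obj C; Y \<in> obj C; Z \<in> obj C; f \<in> mor C X Y; g \<in> mor C Y Z; g' \<in> mor C Y Z\<rbrakk>
        \<Longrightarrow> addm C g g' \<cdot> f = addm C (g \<cdot> f) (g' \<cdot> f)"

definition isomorphic :: "('o, 'm) cat \<Rightarrow> 'o \<Rightarrow> 'o \<Rightarrow> bool" where
  "isomorphic C X Y \<longleftrightarrow> X \<in> obj C \<and> Y \<in> obj C \<and>
     (\<exists>f\<in>mor C X Y. \<exists>g\<in>mor C Y X. g \<cdot>\<^bsub>C\<^esub> f = idm C X \<and> f \<cdot>\<^bsub>C\<^esub> g = idm C Y)"

definition monic :: "('o, 'm) cat \<Rightarrow> 'o \<Rightarrow> 'm \<Rightarrow> 'o \<Rightarrow> bool" where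
  "monic C X f Y \<longleftrightarrow> X \<in> obj C \<and> Y \<in> obj C \<and> f \<in> mor C X Y \<and>
     (\<forall>W\<in>obj C. \<forall>g\<in>mor C W X. \<forall>h\<in>mor C W X. f \<cdot>\<^bsub>C\<^esub> g = f \<cdot>\<^bsub>C\<^esub> h \<longrightarrow> g = h)"

definition epic :: "('o, 'm) cat \<Rightarrow> 'o \<Rightarrow> 'm \<Rightarrow> 'o \<Rightarrow> bool" where
  "epic C X f Y \<longleftrightarrow> X \<in> obj C \<and> Y \<in> obj C \<and> f \<in> mor C X Y \<and>
     (\<forall>W\<in>obj C. \<forall>g\<in>mor C Y W. \<forall>h\<in>mor C Y W. g \<cdot>\<^bsub>C\<^esub> f = h \<cdot>\<^bsub>C\<^esub> f \<longrightarrow> g = h)"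

definition zero_object :: "('o, 'm) cat \<Rightarrow> 'o \<Rightarrow> bool" where
  "zero_object C Z \<longleftrightarrow> Z \<in> obj C \<and>
     (\<forall>X\<in>obj C. (\<exists>!f. f \<in> mor C X Z) \<and> (\<exists>!f. f \<in> mor C Z X))"

definition biproduct ::
    "('o, 'm) cat \<Rightarrow> 'o \<Rightarrow> 'o \<Rightarrow> 'o \<Rightarrow> 'm \<Rightarrow> 'm \<Rightarrow> 'm \<Rightarrow> 'm \<Rightarrow> bool" where
  "biproduct C X Y S i j p q \<longleftrightarrow> X \<in> obj C \<and> Y \<in> obj C \<and> S \<in> obj C \<and>
     i \<in> mor C X S \<and> j \<in> mor C Y S \<and> p \<in> mor C S X \<and> q \<in> mor C S Y \<and>
     p \<cdot>\<^bsub>C\<^esub> i = idm C X \<and> q \<cdot>\<^bsub>C\<^esub> j = idm C Y \<and>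
     p \<cdot>\<^bsub>C\<^esub> j = zerom C Y X \<and> q \<cdot>\<^bsub>C\<^esub> i = zerom C X Y \<and>
     addm C (i \<cdot>\<^bsub>C\<^esub> p) (j \<cdot>\<^bsub>C\<^esub> q) = idm C S"

definition is_kernel :: "('o, 'm) cat \<Rightarrow> 'o \<Rightarrow> 'm \<Rightarrow> 'o \<Rightarrow> 'm \<Rightarrow> 'o \<Rightarrow> bool" where
  "is_kernel C K k X f Y \<longleftrightarrow> K \<in> obj C \<and> X \<in> obj C \<and> Y \<in> obj C \<and>
     k \<in> mor C K X \<and> f \<in> mor C X Y \<and> f \<cdot>\<^bsub>C\<^esub> k = zerom C K Y \<and>
     (\<forall>W\<in>obj C. \<forall>g\<in>mor C W X. f \<cdot>\<^bsub>C\<^esub> g = zerom C W Y \<longrightarrow>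
        (\<exists>!h. h \<in> mor C W K \<and> k \<cdot>\<^bsub>C\<^esub> h = g))"

definition is_cokernel :: "('o, 'm) cat \<Rightarrow> 'o \<Rightarrow> 'm \<Rightarrow> 'o \<Rightarrow> 'm \<Rightarrow> 'o \<Rightarrow> bool" where
  "is_cokernel C X f Y p N \<longleftrightarrow> X \<in> obj C \<and> Y \<in> obj C \<and> N \<in> obj C \<and>
     f \<in> mor C X Y \<and> p \<in> mor C Y N \<and> p \<cdot>\<^bsub>C\<^esub> f = zerom C X N \<and>
     (\<forall>W\<in>obj C. \<forall>g\<in>mor C Y W. g \<cdot>\<^bsub>C\<^esub> f = zerom C X W \<longrightarrow>
        (\<exists>!h. h \<in> mor C N W \<and> h \<cdot>\<^bsub>C\<^esub> p = g))"

locale abelian_category = preadditive_category +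
  assumes ex_zero_object: "\<exists>Z. zero_object C Z"
    and ex_biproduct: "\<lbrakk>X \<in> obj C; Y \<in> obj C\<rbrakk> \<Longrightarrow> \<exists>S i j p q. biproduct C X Y S i j p q"
    and ex_kernel:
      "\<lbrakk>X \<in> obj C; Y \<in> obj C; f \<in> mor C X Y\<rbrakk> \<Longrightarrow> \<exists>K k. is_kernel C K k X f Y"
    and ex_cokernel:
      "\<lbrakk>X \<in> obj C; Y \<in> obj C; f \<in> mor C X Y\<rbrakk> \<Longrightarrow> \<exists>N p. is_cokernel C X f Y p N"
    and monic_is_kernel: "monic C X f Y \<Longrightarrow> \<exists>Z g. is_kernel C X f Y g Z"
    and epic_is_cokernel: "epic C X f Y \<Longrightarrow> \<exists>W g. is_cokernel C W g X f Y"

section \<open>Exactness, projectives and injectives, Ext\<close>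

definition image_factorization ::
    "('o, 'm) cat \<Rightarrow> 'o \<Rightarrow> 'm \<Rightarrow> 'o \<Rightarrow> 'o \<Rightarrow> 'm \<Rightarrow> 'm \<Rightarrow> bool" where
  "image_factorization C X f Y J q i \<longleftrightarrow>
     f \<in> mor C X Y \<and> epic C X q J \<and> monic C J i Y \<and> f = i \<cdot>\<^bsub>C\<^esub> q"

definition exact_at :: "('o, 'm) cat \<Rightarrow> 'o \<Rightarrow> 'm \<Rightarrow> 'o \<Rightarrow> 'm \<Rightarrow> 'o \<Rightarrow> bool" where
  "exact_at C X f Y g Z \<longleftrightarrow>
     (\<exists>J q i. image_factorization C X f Y J q i \<and> is_kernel C J i Y g Z)"

definition short_exact :: "('o, 'm) cat \<Rightarrow> 'o \<Rightarrow> 'm \<Rightarrow> 'o \<Rightarrow> 'm \<Rightarrow> 'o \<Rightarrow> bool" where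
  "short_exact C X f Y g Z \<longleftrightarrow> monic C X f Y \<and> exact_at C X f Y g Z \<and> epic C Y g Z"

definition projective :: "('o, 'm) cat \<Rightarrow> 'o \<Rightarrow> bool" where
  "projective C P \<longleftrightarrow> P \<in> obj C \<and>
     (\<forall>X Y e. epic C X e Y \<longrightarrow> (\<forall>g\<in>mor C P Y. \<exists>h\<in>mor C P X. e \<cdot>\<^bsub>C\<^esub> h = g))"

definition injective :: "('o, 'm) cat \<Rightarrow> 'o \<Rightarrow> bool" where
  "injective C E \<longleftrightarrow> E \<in> obj C \<and>
     (\<forall>X Y k. monic C X k Y \<longrightarrow> (\<forall>g\<in>mor C X E. \<exists>h\<in>mor C Y E. h \<cdot>\<^bsub>C\<^esub> k = g))"

definition enough_projectives :: "('o, 'm) cat \<Rightarrow> bool" where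
  "enough_projectives C \<longleftrightarrow> (\<forall>X\<in>obj C. \<exists>P e. projective C P \<and> epic C P e X)"

definition enough_injectives :: "('o, 'm) cat \<Rightarrow> bool" where
  "enough_injectives C \<longleftrightarrow> (\<forall>X\<in>obj C. \<exists>E k. injective C E \<and> monic C X k E)"

text \<open>A projective resolution \<open>\<dots> \<rightarrow> P 1 \<rightarrow> P 0 \<rightarrow> X \<rightarrow> 0\<close>, with \<open>d n : P (n + 1) \<rightarrow> P n\<close>.\<close>

definition projective_resolution ::
    "('o, 'm) cat \<Rightarrow> 'o \<Rightarrow> (nat \<Rightarrow> 'o) \<Rightarrow> (nat \<Rightarrow> 'm) \<Rightarrow> 'm \<Rightarrow> bool" where
  "projective_resolution C X P d e \<longleftrightarrow>
     (\<forall>n. projective C (P n)) \<and> epic C (P 0) e X \<and>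
     exact_at C (P 1) (d 0) (P 0) e X \<and>
     (\<forall>n. exact_at C (P (Suc (Suc n))) (d (Suc n)) (P (Suc n)) (d n) (P n))"

definition cocycles :: "('o, 'm) cat \<Rightarrow> (nat \<Rightarrow> 'o) \<Rightarrow> (nat \<Rightarrow> 'm) \<Rightarrow> 'o \<Rightarrow> nat \<Rightarrow> 'm set" where
  "cocycles C P d Y n = {a \<in> mor C (P n) Y. a \<cdot>\<^bsub>C\<^esub> d n = zerom C (P (Suc n)) Y}"

fun coboundaries :: "('o, 'm) cat \<Rightarrow> (nat \<Rightarrow> 'o) \<Rightarrow> (nat \<Rightarrow> 'm) \<Rightarrow> 'o \<Rightarrow> nat \<Rightarrow> 'm set" where
  "coboundaries C P d Y 0 = {zerom C (P 0) Y}"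
| "coboundaries C P d Y (Suc n) = (\<lambda>a. a \<cdot>\<^bsub>C\<^esub> d n) ` mor C (P n) Y"

text \<open>
  \<open>Ext C n X Y\<close> is the \<open>n\<close>-th cohomology group of \<open>Hom(P, Y)\<close> for a chosen projective resolution
  \<open>P\<close> of \<open>X\<close>; up to isomorphism it does not depend on the choice.
\<close>

definition Ext :: "('o, 'm) cat \<Rightarrow> nat \<Rightarrow> 'o \<Rightarrow> 'o \<Rightarrow> 'm set monoid" where
  "Ext C n X Y =
     (let (P, d, e) = (SOME (P, d, e). projective_resolution C X P d e)
      in (hom_group C (P n) Y)\<lparr>carrier := cocycles C P d Y n\<rparr> Mod coboundaries C P d Y n)"

definition Ext_vanishes :: "('o, 'm) cat \<Rightarrow> nat \<Rightarrow> 'o set \<Rightarrow> 'o set \<Rightarrow> bool" where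
  "Ext_vanishes C n \<X> \<Y> \<longleftrightarrow> (\<forall>X\<in>\<X>. \<forall>Y\<in>\<Y>. trivial_group (Ext C n X Y))"

section \<open>Classes of objects\<close>

definition additive_class :: "('o, 'm) cat \<Rightarrow> 'o set \<Rightarrow> bool" where
  "additive_class C \<S> \<longleftrightarrow> \<S> \<subseteq> obj C \<and> (\<exists>Z\<in>\<S>. zero_object C Z) \<and>
     (\<forall>X\<in>\<S>. \<forall>Y. isomorphic C X Y \<longrightarrow> Y \<in> \<S>) \<and>
     (\<forall>X\<in>\<S>. \<forall>Y\<in>\<S>. \<forall>S i j p q. biproduct C X Y S i j p q \<longrightarrow> S \<in> \<S>)"

definition extension_closed :: "('o, 'm) cat \<Rightarrow> 'o set \<Rightarrow> bool" where
  "extension_closed C \<S> \<longleftrightarrow>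
     (\<forall>X Y Z f g. short_exact C X f Y g Z \<and> X \<in> \<S> \<and> Z \<in> \<S> \<longrightarrow> Y \<in> \<S>)"

definition App :: "('o, 'm) cat \<Rightarrow> 'o set \<Rightarrow> 'o set \<Rightarrow> 'o set" where
  "App C \<D> \<Q> = {A \<in> obj C. \<exists>D\<in>\<D>. \<exists>Q\<in>\<Q>. \<exists>u v. short_exact C A u D v Q}"

text \<open>
  A filtration \<open>0 = X m \<subseteq> \<dots> \<subseteq> X 1 \<subseteq> X 0 = Y\<close> with \<open>X r / X (r + 1) \<cong> G r\<close>. The step
  \<open>X (r + 1) \<subseteq> X r\<close> is a monomorphism \<open>k r\<close>, and the quotient is a cokernel of \<open>k r\<close>.
\<close>

definition filtration ::
    "('o, 'm) cat \<Rightarrow> nat \<Rightarrow> 'o \<Rightarrow> (nat \<Rightarrow> 'o) \<Rightarrow> (nat \<Rightarrow> 'm) \<Rightarrow> (nat \<Rightarrow> 'o) \<Rightarrow> bool" where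
  "filtration C m Y X k G \<longleftrightarrow> X 0 = Y \<and> zero_object C (X m) \<and>
     (\<forall>r<m. monic C (X (Suc r)) (k r) (X r) \<and>
        (\<exists>p N. is_cokernel C (X (Suc r)) (k r) (X r) p N \<and> isomorphic C N (G r)))"

section \<open>Functors and \<open>\<eta>\<close>-extensions\<close>

record ('o, 'm) endofun =
  fob :: "'o \<Rightarrow> 'o"
  fmor :: "'m \<Rightarrow> 'm"

locale additive_endofunctor =
  fixes B :: "('o, 'm) cat" (structure) and F :: "('o, 'm) endofun"
  assumes fob_closed: "X \<in> obj B \<Longrightarrow> fob F X \<in> obj B"
    and fmor_closed:
      "\<lbrakk>X \<in> obj B; Y \<in> obj B; f \<in> mor B X Y\<rbrakk> \<Longrightarrow> fmor F f \<in> mor B (fob F X) (fob F Y)"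
    and fmor_id: "X \<in> obj B \<Longrightarrow> fmor F (idm B X) = idm B (fob F X)"
    and fmor_cmp:
      "\<lbrakk>X \<in> obj B; Y \<in> obj B; Z \<in> obj B; f \<in> mor B X Y; g \<in> mor B Y Z\<rbrakk>
        \<Longrightarrow> fmor F (g \<cdot> f) = fmor F g \<cdot> fmor F f"
    and fmor_add:
      "\<lbrakk>X \<in> obj B; Y \<in> obj B; f \<in> mor B X Y; g \<in> mor B X Y\<rbrakk>
        \<Longrightarrow> fmor F (addm B f g) = addm B (fmor F f) (fmor F g)"

definition right_exact :: "('o, 'm) cat \<Rightarrow> ('o, 'm) endofun \<Rightarrow> bool" where
  "right_exact B F \<longleftrightarrow> (\<forall>X f Y g Z. short_exact B X f Y g Z \<longrightarrow>
     exact_at B (fob F X) (fmor F f) (fob F Y) (fmor F g) (fob F Z) \<and>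
     epic B (fob F Y) (fmor F g) (fob F Z))"

text \<open>Natural transformations from \<open>F\<^sup>2\<close> to \<open>F\<close>, given by their components.\<close>

definition nat_trans_sq ::
    "('o, 'm) cat \<Rightarrow> ('o, 'm) endofun \<Rightarrow> ('o \<Rightarrow> 'm) \<Rightarrow> bool" where
  "nat_trans_sq B F \<eta> \<longleftrightarrow>
     (\<forall>X\<in>obj B. \<eta> X \<in> mor B (fob F (fob F X)) (fob F X)) \<and>
     (\<forall>X\<in>obj B. \<forall>Y\<in>obj B. \<forall>f\<in>mor B X Y.
        fmor F f \<cdot>\<^bsub>B\<^esub> \<eta> X = \<eta> Y \<cdot>\<^bsub>B\<^esub> fmor F (fmor F f))"

definition associative_trans ::
    "('o, 'm) cat \<Rightarrow> ('o, 'm) endofun \<Rightarrow> ('o \<Rightarrow> 'm) \<Rightarrow> bool" where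
  "associative_trans B F \<eta> \<longleftrightarrow>
     (\<forall>X\<in>obj B. \<eta> X \<cdot>\<^bsub>B\<^esub> fmor F (\<eta> X) = \<eta> X \<cdot>\<^bsub>B\<^esub> \<eta> (fob F X))"

definition eta_extension ::
    "('o, 'm) cat \<Rightarrow> ('o, 'm) endofun \<Rightarrow> ('o \<Rightarrow> 'm) \<Rightarrow> ('o \<times> 'm, 'm) cat" where
  "eta_extension B F \<eta> =
     \<lparr>obj = {(X, f). X \<in> obj B \<and> f \<in> mor B (fob F X) X \<and>
                f \<cdot>\<^bsub>B\<^esub> fmor F f = f \<cdot>\<^bsub>B\<^esub> \<eta> X},
      mor = (\<lambda>(X, f) (X', f'). {\<alpha> \<in> mor B X X'. \<alpha> \<cdot>\<^bsub>B\<^esub> f = f' \<cdot>\<^bsub>B\<^esub> fmor F \<alpha>}),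
      cmp = cmp B,
      idm = (\<lambda>(X, f). idm B X),
      addm = addm B,
      zerom = (\<lambda>(X, f) (X', f'). zerom B X X')\<rparr>"

definition Z_obj :: "('o, 'm) cat \<Rightarrow> ('o, 'm) endofun \<Rightarrow> 'o \<Rightarrow> 'o \<times> 'm" where
  "Z_obj B F X = (X, zerom B (fob F X) X)"

text \<open>Cokernels and images are chosen; all notions below are invariant under isomorphism.\<close>

definition C_obj :: "('o, 'm) cat \<Rightarrow> ('o, 'm) endofun \<Rightarrow> 'o \<times> 'm \<Rightarrow> 'o" where
  "C_obj B F = (\<lambda>(X, f). SOME N. \<exists>p. is_cokernel B (fob F X) f X p N)"

definition eta_image :: "('o, 'm) cat \<Rightarrow> ('o, 'm) endofun \<Rightarrow> 'o \<times> 'm \<Rightarrow> 'o \<times> 'm" where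
  "eta_image B F = (\<lambda>(X, f).
     let (J, q, i) = (SOME (J, q, i). image_factorization B (fob F X) f X J q i)
     in (J, q \<cdot>\<^bsub>B\<^esub> fmor F i))"

definition eta_image_pow ::
    "('o, 'm) cat \<Rightarrow> ('o, 'm) endofun \<Rightarrow> nat \<Rightarrow> 'o \<times> 'm \<Rightarrow> 'o \<times> 'm" where
  "eta_image_pow B F r A = (eta_image B F ^^ r) A"

definition Loewy_factor ::
    "('o, 'm) cat \<Rightarrow> ('o, 'm) endofun \<Rightarrow> nat \<Rightarrow> 'o \<times> 'm \<Rightarrow> 'o \<times> 'm" where
  "Loewy_factor B F r A = Z_obj B F (C_obj B F (eta_image_pow B F r A))"

definition image_nilpotent ::
    "('o, 'm) cat \<Rightarrow> ('o, 'm) endofun \<Rightarrow> ('o \<Rightarrow> 'm) \<Rightarrow> 'o \<times> 'm \<Rightarrow> bool" where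
  "image_nilpotent B F \<eta> A \<longleftrightarrow> (\<exists>d. zero_object (eta_extension B F \<eta>) (eta_image_pow B F d A))"

definition Loewy_length ::
    "('o, 'm) cat \<Rightarrow> ('o, 'm) endofun \<Rightarrow> ('o \<Rightarrow> 'm) \<Rightarrow> 'o \<times> 'm \<Rightarrow> nat" where
  "Loewy_length B F \<eta> A = (LEAST d. zero_object (eta_extension B F \<eta>) (eta_image_pow B F d A))"

end

theory Submission
  imports Defs
begin

text \<open>
  The heart of the matter is a horseshoe construction in an arbitrary abelian category. Given a
  short exact sequence \<open>A' \<rightarrow> A \<rightarrow> A''\<close> and coresolutions \<open>A' \<rightarrow> D' \<rightarrow> Q'\<close>, \<open>A'' \<rightarrow> D'' \<rightarrow> Q''\<close>, push
  out \<open>A' \<rightarrow> A\<close> along \<open>A' \<rightarrow> D'\<close> to an extension \<open>E\<close> of \<open>A''\<close> by \<open>D'\<close>. As \<open>Ext\<^sup>2(Q'', D') = 0\<close>, this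
  extension is restricted from an extension \<open>D\<close> of \<open>D''\<close> by \<open>D'\<close>: for a first syzygy \<open>K \<rightarrow> P\<close> of \<open>Q''\<close>,
  the map \<open>K \<rightarrow> A''\<close> induced by a lift \<open>P \<rightarrow> D''\<close> lifts further to \<open>K \<rightarrow> E\<close>, and \<open>D\<close> is the
  pushout of \<open>K \<rightarrow> P\<close> along it. Then \<open>A \<rightarrow> E \<rightarrow> D\<close> is monic and its cokernel is an extension of \<open>Q''\<close>
  by \<open>Q'\<close>. Since right exactness of \<open>F\<close> makes kernels and cokernels of the \<open>\<eta>\<close>-extension
  computable in \<open>B\<close>, it is abelian, and the horseshoe is iterated up the Loewy filtration.
\<close>

section \<open>Morphisms, kernels and cokernels\<close>

text \<open>Hom-sets may overlap, so a morphism does not determine its source and target. Bundling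
  both objects with the membership makes typing facts self-contained, and those of composites can be
  chained with \<open>OF\<close>.\<close>

definition arr :: "('o, 'm) cat \<Rightarrow> 'o \<Rightarrow> 'm \<Rightarrow> 'o \<Rightarrow> bool" where
  "arr C X f Y \<longleftrightarrow> X \<in> obj C \<and> Y \<in> obj C \<and> f \<in> mor C X Y"

lemma arr_obj:
  assumes "arr C X f Y" shows "X \<in> obj C" "Y \<in> obj C"
  using assms by (auto simp: arr_def)

context category
begin

lemma comp_arr [intro]: "\<lbrakk>arr C X f Y; arr C Y g Z\<rbrakk> \<Longrightarrow> arr C X (g \<cdot> f) Z"
  using cmp_closed by (auto simp: arr_def)

lemma id_arr [intro]: "X \<in> obj C \<Longrightarrow> arr C X (idm C X) X"
  using idm_closed by (auto simp: arr_def)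

lemma comp_assoc:
  "\<lbrakk>arr C W f X; arr C X g Y; arr C Y h Z\<rbrakk> \<Longrightarrow> h \<cdot> (g \<cdot> f) = (h \<cdot> g) \<cdot> f"
  using cmp_assoc by (auto simp: arr_def)

lemma comp_id_right: "arr C X f Y \<Longrightarrow> f \<cdot> idm C X = f"
  using idm_right by (auto simp: arr_def)

lemma comp_id_left: "arr C X f Y \<Longrightarrow> idm C Y \<cdot> f = f"
  using idm_left by (auto simp: arr_def)

text \<open>Associativity holds only for typed morphisms. This lemma and the next replace a
  composable pair inside a longer composite by its known value \<open>e\<close>.\<close>

lemma comp_eq_left:
  "\<lbrakk>arr C W x X; arr C X f Y; arr C Y g Z; g \<cdot> f = e\<rbrakk> \<Longrightarrow> g \<cdot> (f \<cdot> x) = e \<cdot> x"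
  using comp_assoc by simp

lemma comp_eq_right:
  "\<lbrakk>arr C W f X; arr C X g Y; arr C Y x Z; g \<cdot> f = e\<rbrakk> \<Longrightarrow> (x \<cdot> g) \<cdot> f = x \<cdot> e"
  using comp_assoc[of W f X g Y x Z] by simp

lemma monicI:
  assumes "arr C X f Y" "\<And>W g h. \<lbrakk>arr C W g X; arr C W h X; f \<cdot> g = f \<cdot> h\<rbrakk> \<Longrightarrow> g = h"
  shows "monic C X f Y"
  using assms by (auto simp: monic_def arr_def)

lemma monic_arr: "monic C X f Y \<Longrightarrow> arr C X f Y"
  by (auto simp: monic_def arr_def)

lemma monicD: "\<lbrakk>monic C X f Y; arr C W g X; arr C W h X; f \<cdot> g = f \<cdot> h\<rbrakk> \<Longrightarrow> g = h"
  by (auto simp: monic_def arr_def)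

lemma epicI:
  assumes "arr C X f Y" "\<And>W g h. \<lbrakk>arr C Y g W; arr C Y h W; g \<cdot> f = h \<cdot> f\<rbrakk> \<Longrightarrow> g = h"
  shows "epic C X f Y"
  using assms by (auto simp: epic_def arr_def)

lemma epic_arr: "epic C X f Y \<Longrightarrow> arr C X f Y"
  by (auto simp: epic_def arr_def)

lemma epicD: "\<lbrakk>epic C X f Y; arr C Y g W; arr C Y h W; g \<cdot> f = h \<cdot> f\<rbrakk> \<Longrightarrow> g = h"
  by (auto simp: epic_def arr_def)

lemma monic_id: "X \<in> obj C \<Longrightarrow> monic C X (idm C X) X"
  by (rule monicI) (auto simp: comp_id_left)

lemma epic_id: "X \<in> obj C \<Longrightarrow> epic C X (idm C X) X"
  by (rule epicI) (auto simp: comp_id_right)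

lemma monic_comp:
  assumes f: "monic C X f Y" and g: "monic C Y g Z"
  shows "monic C X (g \<cdot> f) Z"
proof (rule monicI)
  note fa = monic_arr[OF f] and ga = monic_arr[OF g]
  show "arr C X (g \<cdot> f) Z" using fa ga by auto
  fix W x y assume x: "arr C W x X" and y: "arr C W y X" and "(g \<cdot> f) \<cdot> x = (g \<cdot> f) \<cdot> y"
  then have "g \<cdot> (f \<cdot> x) = g \<cdot> (f \<cdot> y)" using fa ga comp_assoc by metis
  then have "f \<cdot> x = f \<cdot> y" using monicD[OF g] x y fa by blast
  then show "x = y" using monicD[OF f] x y by blast
qed

lemma monic_cancel:
  assumes "monic C X (g \<cdot> f) Z" "arr C X f Y" "arr C Y g Z"
  shows "monic C X f Y"
proof (rule monicI)
  fix W x y assume x: "arr C W x X" and y: "arr C W y X" and "f \<cdot> x = f \<cdot> y"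
  then have "(g \<cdot> f) \<cdot> x = (g \<cdot> f) \<cdot> y"
    using comp_assoc[OF x assms(2,3)] comp_assoc[OF y assms(2,3)] by simp
  then show "x = y" using monicD[OF assms(1) x y] by simp
qed (use assms in auto)

lemma epic_cancel:
  assumes "epic C X (g \<cdot> f) Z" "arr C X f Y" "arr C Y g Z"
  shows "epic C Y g Z"
proof (rule epicI)
  fix W x y assume x: "arr C Z x W" and y: "arr C Z y W" and "x \<cdot> g = y \<cdot> g"
  then have "x \<cdot> (g \<cdot> f) = y \<cdot> (g \<cdot> f)"
    using comp_assoc[OF assms(2,3) x] comp_assoc[OF assms(2,3) y] by simp
  then show "x = y" using epicD[OF assms(1) x y] by simp
qed (use assms in auto)

lemma isomorphic_refl: "X \<in> obj C \<Longrightarrow> isomorphic C X X"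
  unfolding isomorphic_def using idm_closed idm_left by blast

lemma zero_object_isomorphic:
  assumes Z: "zero_object C Z" and Z': "zero_object C Z'"
  shows "isomorphic C Z Z'"
proof -
  have o: "Z \<in> obj C" "Z' \<in> obj C" using Z Z' by (auto simp: zero_object_def)
  obtain f where f: "f \<in> mor C Z Z'" using Z o unfolding zero_object_def by blast
  obtain g where g: "g \<in> mor C Z' Z" using Z o unfolding zero_object_def by blast
  have "\<exists>!f. f \<in> mor C Z Z" "\<exists>!f. f \<in> mor C Z' Z'"
    using Z Z' o unfolding zero_object_def by auto
  moreover have "g \<cdot> f \<in> mor C Z Z" "f \<cdot> g \<in> mor C Z' Z'"
    using cmp_closed[OF o(1,2,1) f g] cmp_closed[OF o(2,1,2) g f] .
  ultimately have "g \<cdot> f = idm C Z" "f \<cdot> g = idm C Z'" using idm_closed o by blast+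
  then show ?thesis using f g o unfolding isomorphic_def by blast
qed

lemma kernel_arr:
  assumes "is_kernel C K k X f Y"
  shows "arr C K k X" "arr C X f Y" "f \<cdot> k = zerom C K Y"
  using assms by (auto simp: is_kernel_def arr_def)

lemma kernel_factor:
  assumes "is_kernel C K k X f Y" "arr C W g X" "f \<cdot> g = zerom C W Y"
  obtains h where "arr C W h K" "k \<cdot> h = g"
  using assms unfolding is_kernel_def arr_def by metis

text \<open>Uniqueness of the factorization is what monicity of \<open>k\<close> provides, so only
  its existence is left to check.\<close>

lemma is_kernelI:
  assumes "arr C X f Y" "f \<cdot> k = zerom C K Y" "monic C K k X"
    and "\<And>W g. \<lbrakk>arr C W g X; f \<cdot> g = zerom C W Y\<rbrakk> \<Longrightarrow> \<exists>h. arr C W h K \<and> k \<cdot> h = g"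
  shows "is_kernel C K k X f Y"
  unfolding is_kernel_def
proof (intro conjI ballI impI)
  fix W g assume "W \<in> obj C" "g \<in> mor C W X" "f \<cdot> g = zerom C W Y"
  then obtain h where h: "arr C W h K" "k \<cdot> h = g"
    using assms(1,4) unfolding arr_def by blast
  show "\<exists>!h. h \<in> mor C W K \<and> k \<cdot> h = g"
  proof (rule ex1I)
    show "h \<in> mor C W K \<and> k \<cdot> h = g" using h by (auto simp: arr_def)
    fix h' assume "h' \<in> mor C W K \<and> k \<cdot> h' = g"
    then show "h' = h" using h monicD[OF assms(3), of W h' h] by (auto simp: arr_def)
  qed
qed (use assms monic_arr in \<open>auto simp: arr_def\<close>)

lemma cokernel_arr:
  assumes "is_cokernel C X f Y p N"
  shows "arr C X f Y" "arr C Y p N" "p \<cdot> f = zerom C X N"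
  using assms by (auto simp: is_cokernel_def arr_def)

lemma cokernel_factor:
  assumes "is_cokernel C X f Y p N" "arr C Y g W" "g \<cdot> f = zerom C X W"
  obtains h where "arr C N h W" "h \<cdot> p = g"
  using assms unfolding is_cokernel_def arr_def by metis

lemma is_cokernelI:
  assumes "arr C X f Y" "p \<cdot> f = zerom C X N" "epic C Y p N"
    and "\<And>W g. \<lbrakk>arr C Y g W; g \<cdot> f = zerom C X W\<rbrakk> \<Longrightarrow> \<exists>h. arr C N h W \<and> h \<cdot> p = g"
  shows "is_cokernel C X f Y p N"
  unfolding is_cokernel_def
proof (intro conjI ballI impI)
  fix W g assume "W \<in> obj C" "g \<in> mor C Y W" "g \<cdot> f = zerom C X W"
  then obtain h where h: "arr C N h W" "h \<cdot> p = g"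
    using assms(1,4) unfolding arr_def by blast
  show "\<exists>!h. h \<in> mor C N W \<and> h \<cdot> p = g"
  proof (rule ex1I)
    show "h \<in> mor C N W \<and> h \<cdot> p = g" using h by (auto simp: arr_def)
    fix h' assume "h' \<in> mor C N W \<and> h' \<cdot> p = g"
    then show "h' = h" using h epicD[OF assms(3), of h' W h] by (auto simp: arr_def)
  qed
qed (use assms epic_arr in \<open>auto simp: arr_def\<close>)

end

section \<open>Zero morphisms, differences and cancellation in hom-groups\<close>

context preadditive_category
begin

lemma zero_arr [intro]: "\<lbrakk>X \<in> obj C; Y \<in> obj C\<rbrakk> \<Longrightarrow> arr C X (zerom C X Y) Y"
  using hom_comm_group[of X Y] monoid.one_closed[of "hom_group C X Y"]
  by (auto simp: arr_def hom_group_def comm_group_def group_def)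

lemma add_arr [intro]: "\<lbrakk>arr C X f Y; arr C X g Y\<rbrakk> \<Longrightarrow> arr C X (addm C f g) Y"
  using hom_comm_group[of X Y] monoid.m_closed[of "hom_group C X Y" f g]
  by (auto simp: arr_def hom_group_def comm_group_def group_def)

lemma hom_group: "\<lbrakk>X \<in> obj C; Y \<in> obj C\<rbrakk> \<Longrightarrow> group (hom_group C X Y)"
  using hom_comm_group by (auto simp: comm_group_def)

lemma carrier_hom_group: "carrier (hom_group C X Y) = mor C X Y"
  by (simp add: hom_group_def)

lemma add_zero:
  assumes "arr C X f Y"
  shows "addm C f (zerom C X Y) = f" "addm C (zerom C X Y) f = f"
proof -
  interpret group "hom_group C X Y" using hom_group assms by (auto simp: arr_def)
  show "addm C f (zerom C X Y) = f" "addm C (zerom C X Y) f = f"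
    using r_one[of f] l_one[of f] assms by (auto simp: arr_def hom_group_def)
qed

text \<open>Subtraction without a negation symbol: \<open>cat\<close> records only sums and zeros,
  so \<open>f - g\<close> is carried as some \<open>d\<close> with \<open>d + g = f\<close>.
  Composition and additive functors preserve this relation directly.\<close>

lemma ex_difference:
  assumes f: "arr C X f Y" and g: "arr C X g Y"
  obtains d where "arr C X d Y" "addm C d g = f"
proof -
  interpret group "hom_group C X Y" using hom_group f by (auto simp: arr_def)
  have "f \<otimes>\<^bsub>hom_group C X Y\<^esub> inv\<^bsub>hom_group C X Y\<^esub> g \<in> carrier (hom_group C X Y)"
    and "f \<otimes>\<^bsub>hom_group C X Y\<^esub> inv\<^bsub>hom_group C X Y\<^esub> g \<otimes>\<^bsub>hom_group C X Y\<^esub> g = f"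
    using f g by (auto simp: arr_def m_assoc simp flip: carrier_hom_group)
  then show ?thesis using that f by (auto simp: arr_def hom_group_def)
qed

text \<open>The usual way to recognise a zero morphism: a composite with zero, or the image of zero
  under an additive functor, satisfies \<open>x + x = x\<close>.\<close>

lemma add_eq_self:
  assumes f: "arr C X f Y" and g: "arr C X g Y" and "addm C f g = g"
  shows "f = zerom C X Y"
proof -
  interpret group "hom_group C X Y" using hom_group f by (auto simp: arr_def)
  show ?thesis using r_cancel_one'[of g f] assms by (auto simp: arr_def hom_group_def)
qed

lemma add_right_cancel:
  assumes "arr C X f Y" "arr C X g Y" "arr C X h Y" "addm C f h = addm C g h"
  shows "f = g"
proof -
  interpret group "hom_group C X Y" using hom_group assms(1) by (auto simp: arr_def)
  show ?thesis using right_cancel[of h f g] assms by (auto simp: arr_def hom_group_def)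
qed

lemma comp_add_right:
  "\<lbrakk>arr C X f Y; arr C X f' Y; arr C Y g Z\<rbrakk> \<Longrightarrow> g \<cdot> addm C f f' = addm C (g \<cdot> f) (g \<cdot> f')"
  using cmp_add_right by (auto simp: arr_def)

lemma comp_add_left:
  "\<lbrakk>arr C X f Y; arr C Y g Z; arr C Y g' Z\<rbrakk> \<Longrightarrow> addm C g g' \<cdot> f = addm C (g \<cdot> f) (g' \<cdot> f)"
  using cmp_add_left by (auto simp: arr_def)

lemma comp_zero_right:
  assumes g: "arr C Y g Z" and X: "X \<in> obj C"
  shows "g \<cdot> zerom C X Y = zerom C X Z"
proof -
  have z: "arr C X (zerom C X Y) Y" by (intro zero_arr X arr_obj(1)[OF g])
  have "addm C (g \<cdot> zerom C X Y) (g \<cdot> zerom C X Y) = g \<cdot> zerom C X Y"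
    unfolding comp_add_right[OF z z g, symmetric] add_zero[OF z] ..
  then show ?thesis by (rule add_eq_self[OF comp_arr[OF z g] comp_arr[OF z g]])
qed

lemma comp_zero_left:
  assumes f: "arr C X f Y" and Z: "Z \<in> obj C"
  shows "zerom C Y Z \<cdot> f = zerom C X Z"
proof -
  have z: "arr C Y (zerom C Y Z) Z" by (intro zero_arr Z arr_obj(2)[OF f])
  have "addm C (zerom C Y Z \<cdot> f) (zerom C Y Z \<cdot> f) = zerom C Y Z \<cdot> f"
    unfolding comp_add_left[OF f z z, symmetric] add_zero[OF z] ..
  then show ?thesis by (rule add_eq_self[OF comp_arr[OF f z] comp_arr[OF f z]])
qed

text \<open>If \<open>f \<cdot> g = f \<cdot> h\<close>, then \<open>f\<close> kills the difference
  \<open>d\<close> of \<open>g\<close> and \<open>h\<close>, so testing on zero composites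
  suffices.\<close>

lemma monic_zeroI:
  assumes f: "arr C X f Y"
    and *: "\<And>W z. \<lbrakk>arr C W z X; f \<cdot> z = zerom C W Y\<rbrakk> \<Longrightarrow> z = zerom C W X"
  shows "monic C X f Y"
proof (rule monicI[OF f])
  fix W g h assume g: "arr C W g X" and h: "arr C W h X" and eq: "f \<cdot> g = f \<cdot> h"
  obtain d where d: "arr C W d X" "addm C d h = g" using ex_difference[OF g h] .
  then have "addm C (f \<cdot> d) (f \<cdot> h) = f \<cdot> h" using comp_add_right[OF d(1) h f] eq by simp
  then have "d = zerom C W X" using * d(1) add_eq_self comp_arr f h by blast
  then show "g = h" using d add_zero[OF h] by simp
qed

lemma epic_zeroI:
  assumes f: "arr C X f Y"
    and *: "\<And>W z. \<lbrakk>arr C Y z W; z \<cdot> f = zerom C X W\<rbrakk> \<Longrightarrow> z = zerom C Y W"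
  shows "epic C X f Y"
proof (rule epicI[OF f])
  fix W g h assume g: "arr C Y g W" and h: "arr C Y h W" and eq: "g \<cdot> f = h \<cdot> f"
  obtain d where d: "arr C Y d W" "addm C d h = g" using ex_difference[OF g h] .
  then have "addm C (d \<cdot> f) (h \<cdot> f) = h \<cdot> f" using comp_add_left[OF f d(1) h] eq by simp
  then have "d = zerom C Y W" using * d(1) add_eq_self comp_arr f h by blast
  then show "g = h" using d add_zero[OF h] by simp
qed

lemma monic_zeroD:
  "\<lbrakk>monic C X f Y; arr C W z X; f \<cdot> z = zerom C W Y\<rbrakk> \<Longrightarrow> z = zerom C W X"
  using monicD[of X f Y W z "zerom C W X"] comp_zero_right monic_arr zero_arr arr_obj by metis

lemma epic_zeroD:
  "\<lbrakk>epic C X f Y; arr C Y z W; z \<cdot> f = zerom C X W\<rbrakk> \<Longrightarrow> z = zerom C Y W"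
  using epicD[of X f Y z W "zerom C Y W"] comp_zero_left epic_arr zero_arr arr_obj by metis

text \<open>Both \<open>g\<close> and \<open>h\<close> factor the same map
  \<open>k \<cdot> g\<close> through the kernel, so the uniqueness clause identifies them.\<close>

lemma kernel_monic:
  assumes K: "is_kernel C K k X f Y"
  shows "monic C K k X"
proof (rule monicI)
  note k = kernel_arr[OF K]
  show "arr C K k X" by (rule k)
  fix W g h assume g: "arr C W g K" and h: "arr C W h K" and eq: "k \<cdot> g = k \<cdot> h"
  have W: "W \<in> obj C" using arr_obj[OF g] by simp
  have "f \<cdot> (k \<cdot> g) = zerom C W Y"
    using comp_eq_left[OF g k] comp_zero_left[OF g, of Y] arr_obj[OF k(2)] by simp
  moreover have "k \<cdot> g \<in> mor C W X" using comp_arr[OF g k(1)] by (simp add: arr_def)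
  ultimately have "\<exists>!h'. h' \<in> mor C W K \<and> k \<cdot> h' = k \<cdot> g"
    using K W unfolding is_kernel_def by blast
  moreover have "g \<in> mor C W K" "h \<in> mor C W K" using g h by (auto simp: arr_def)
  ultimately show "g = h" using eq by auto
qed

lemma cokernel_epic:
  assumes K: "is_cokernel C X f Y p N"
  shows "epic C Y p N"
proof (rule epicI)
  note p = cokernel_arr[OF K]
  show "arr C Y p N" by (rule p)
  fix W g h assume g: "arr C N g W" and h: "arr C N h W" and eq: "g \<cdot> p = h \<cdot> p"
  have W: "W \<in> obj C" using arr_obj[OF g] by simp
  have "(g \<cdot> p) \<cdot> f = zerom C X W"
    using comp_eq_right[OF p(1,2) g p(3)] comp_zero_right[OF g, of X] arr_obj[OF p(1)] by simp
  moreover have "g \<cdot> p \<in> mor C Y W" using comp_arr[OF p(2) g] by (simp add: arr_def)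
  ultimately have "\<exists>!h'. h' \<in> mor C N W \<and> h' \<cdot> p = g \<cdot> p"
    using K W unfolding is_cokernel_def by blast
  moreover have "g \<in> mor C N W" "h \<in> mor C N W" using g h by (auto simp: arr_def)
  ultimately show "g = h" using eq by auto
qed

lemma zero_objectD:
  assumes "zero_object C Z"
  shows "arr C X f Z \<Longrightarrow> f = zerom C X Z" "arr C Z f X \<Longrightarrow> f = zerom C Z X"
proof -
  assume f: "arr C X f Z"
  then have "f \<in> mor C X Z" "zerom C X Z \<in> mor C X Z" "\<exists>!f. f \<in> mor C X Z"
    using assms zero_arr[of X Z] unfolding zero_object_def arr_def by auto
  then show "f = zerom C X Z" by blast
next
  assume f: "arr C Z f X"
  then have "f \<in> mor C Z X" "zerom C Z X \<in> mor C Z X" "\<exists>!f. f \<in> mor C Z X"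
    using assms zero_arr[of Z X] unfolding zero_object_def arr_def by auto
  then show "f = zerom C Z X" by blast
qed

end

section \<open>Abelian categories and pushouts\<close>

definition is_pushout ::
    "('o, 'm) cat \<Rightarrow> 'o \<Rightarrow> 'm \<Rightarrow> 'o \<Rightarrow> 'm \<Rightarrow> 'o \<Rightarrow> 'o \<Rightarrow> 'm \<Rightarrow> 'm \<Rightarrow> bool" where
  "is_pushout C A f B g X P g' f' \<longleftrightarrow>
     arr C A f B \<and> arr C A g X \<and> arr C B g' P \<and> arr C X f' P \<and> g' \<cdot>\<^bsub>C\<^esub> f = f' \<cdot>\<^bsub>C\<^esub> g \<and>
     (\<forall>W x y. arr C B x W \<and> arr C X y W \<and> x \<cdot>\<^bsub>C\<^esub> f = y \<cdot>\<^bsub>C\<^esub> g \<longrightarrow>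
        (\<exists>!h. arr C P h W \<and> h \<cdot>\<^bsub>C\<^esub> g' = x \<and> h \<cdot>\<^bsub>C\<^esub> f' = y))"

lemma is_pushoutD:
  assumes "is_pushout C A f B g X P g' f'"
  shows "arr C A f B" "arr C A g X" "arr C B g' P" "arr C X f' P" "g' \<cdot>\<^bsub>C\<^esub> f = f' \<cdot>\<^bsub>C\<^esub> g"
  using assms unfolding is_pushout_def by auto

lemma is_pushout_sym:
  assumes P: "is_pushout C A f B g X P g' f'"
  shows "is_pushout C A g X f B P f' g'"
  unfolding is_pushout_def
proof (intro conjI allI impI is_pushoutD[OF P] is_pushoutD(5)[OF P, symmetric])
  fix W x y assume "arr C X x W \<and> arr C B y W \<and> x \<cdot>\<^bsub>C\<^esub> g = y \<cdot>\<^bsub>C\<^esub> f"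
  then have "\<exists>!h. arr C P h W \<and> h \<cdot>\<^bsub>C\<^esub> g' = y \<and> h \<cdot>\<^bsub>C\<^esub> f' = x"
    using P unfolding is_pushout_def by simp
  then show "\<exists>!h. arr C P h W \<and> h \<cdot>\<^bsub>C\<^esub> f' = x \<and> h \<cdot>\<^bsub>C\<^esub> g' = y"
    by (simp add: conj_ac)
qed

lemma pushout_factor:
  assumes "is_pushout C A f B g X P g' f'"
    and "arr C B x W" "arr C X y W" "x \<cdot>\<^bsub>C\<^esub> f = y \<cdot>\<^bsub>C\<^esub> g"
  obtains h where "arr C P h W" "h \<cdot>\<^bsub>C\<^esub> g' = x" "h \<cdot>\<^bsub>C\<^esub> f' = y"
  using assms unfolding is_pushout_def by blast

section \<open>Cokernels and their behaviour under pushouts\<close>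

context preadditive_category
begin

lemma comp_zeroL:
  assumes "g \<cdot> f = zerom C X Z" "arr C W x X" "arr C X f Y" "arr C Y g Z"
  shows "g \<cdot> (f \<cdot> x) = zerom C W Z"
  using comp_eq_left[OF assms(2-4,1)] comp_zero_left[OF assms(2)] arr_obj(2)[OF assms(4)] by simp

lemma comp_zeroR:
  assumes "g \<cdot> f = zerom C X Z" "arr C X f Y" "arr C Y g Z" "arr C Z h V"
  shows "(h \<cdot> g) \<cdot> f = zerom C X V"
  using comp_eq_right[OF assms(2-4,1)] comp_zero_right[OF assms(4)] arr_obj(1)[OF assms(2)] by simp

text \<open>As \<open>q\<close> is epic, a map kills \<open>i \<cdot> q\<close> exactly when it
  kills \<open>i\<close>, so the two morphisms have the same cokernel.\<close>

lemma cokernel_of_image: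
  assumes p: "is_cokernel C X (i \<cdot> q) Y p N" and q: "epic C X q J" and i: "arr C J i Y"
  shows "is_cokernel C J i Y p N"
proof (rule is_cokernelI[OF i _ cokernel_epic[OF p]])
  note pa = cokernel_arr[OF p] and qa = epic_arr[OF q]
  have "(p \<cdot> i) \<cdot> q = zerom C X N" using comp_assoc[OF qa i pa(2)] pa(3) by simp
  then show "p \<cdot> i = zerom C J N" by (rule epic_zeroD[OF q comp_arr[OF i pa(2)]])
  fix W g assume g: "arr C Y g W" "g \<cdot> i = zerom C J W"
  have "g \<cdot> (i \<cdot> q) = zerom C X W" by (rule comp_zeroL[OF g(2) qa i g(1)])
  then show "\<exists>h. arr C N h W \<and> h \<cdot> p = g" using cokernel_factor[OF p g(1)] by blast
qed

lemma pushout_unique: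
  assumes P: "is_pushout C A f B g X P g' f'"
    and h: "arr C P h W" and k: "arr C P k W"
    and eq: "h \<cdot> g' = k \<cdot> g'" "h \<cdot> f' = k \<cdot> f'"
  shows "h = k"
proof -
  note a = is_pushoutD[OF P]
  have "(h \<cdot> g') \<cdot> f = (h \<cdot> f') \<cdot> g"
    using comp_assoc[OF a(1,3) h] comp_assoc[OF a(2,4) h] a(5) by simp
  then have "\<exists>!l. arr C P l W \<and> l \<cdot> g' = h \<cdot> g' \<and> l \<cdot> f' = h \<cdot> f'"
    using P comp_arr[OF a(3) h] comp_arr[OF a(4) h] unfolding is_pushout_def by blast
  then show ?thesis using h k eq by auto
qed

text \<open>The pair \<open>p\<close>, 0 is compatible on \<open>A\<close> and induces
  \<open>p'\<close>. A map on the pushout that kills \<open>f'\<close> is determined by its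
  restriction to \<open>B\<close>, which kills \<open>f\<close> and so factors through
  \<open>p\<close>.\<close>

lemma pushout_cokernel:
  assumes P: "is_pushout C A f B g X P g' f'" and p: "is_cokernel C A f B p N"
  obtains p' where "is_cokernel C X f' P p' N" "p' \<cdot> g' = p"
proof -
  note a = is_pushoutD[OF P] and pa = cokernel_arr[OF p]
  have obs: "X \<in> obj C" "N \<in> obj C" using arr_obj[OF a(2)] arr_obj[OF pa(2)] by auto
  have z: "p \<cdot> f = zerom C X N \<cdot> g" using pa(3) comp_zero_left[OF a(2) obs(2)] by simp
  obtain p' where p': "arr C P p' N" "p' \<cdot> g' = p" "p' \<cdot> f' = zerom C X N"
    using pushout_factor[OF P pa(2) zero_arr[OF obs] z] .
  have "is_cokernel C X f' P p' N"
  proof (rule is_cokernelI[OF a(4) p'(3)])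
    show "epic C P p' N" using epic_cancel[OF _ a(3) p'(1)] p'(2) cokernel_epic[OF p] by simp
    fix W h assume h: "arr C P h W" "h \<cdot> f' = zerom C X W"
    have "(h \<cdot> g') \<cdot> f = h \<cdot> (f' \<cdot> g)" using comp_assoc[OF a(1,3) h(1)] a(5) by simp
    also have "\<dots> = zerom C A W"
      using comp_zeroL[OF h(2) a(2,4) h(1)] .
    finally obtain k where k: "arr C N k W" "k \<cdot> p = h \<cdot> g'"
      using cokernel_factor[OF p comp_arr[OF a(3) h(1)]] by blast
    have "k \<cdot> p' = h"
    proof (rule pushout_unique[OF P comp_arr[OF p'(1) k(1)] h(1)])
      show "(k \<cdot> p') \<cdot> g' = h \<cdot> g'" using comp_eq_right[OF a(3) p'(1) k(1) p'(2)] k(2) by simp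
      show "(k \<cdot> p') \<cdot> f' = h \<cdot> f'" using comp_zeroR[OF p'(3) a(4) p'(1) k(1)] h(2) by simp
    qed
    then show "\<exists>k. arr C N k W \<and> k \<cdot> p' = h" using k(1) by blast
  qed
  then show thesis using that p'(2) by blast
qed

text \<open>A map on \<open>D\<close> killing \<open>j \<cdot> i\<close> restricts to
  \<open>E\<close> as a map killing \<open>i\<close>. It therefore factors through \<open>N\<close>
  there, and the two pieces glue to a map on the pushout \<open>R\<close>. This identifies quotients
  such as D/A once E/A is known.\<close>

lemma pushout_of_cokernel:
  assumes P: "is_pushout C E p N j D R j' p'" and p: "is_cokernel C A i E p N"
  shows "is_cokernel C A (j \<cdot> i) D p' R"
proof -
  note a = is_pushoutD[OF P] and pa = cokernel_arr[OF p]
  have ji: "arr C A (j \<cdot> i) D" by (rule comp_arr[OF pa(1) a(2)])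
  show ?thesis
  proof (rule is_cokernelI[OF ji])
    have "p' \<cdot> (j \<cdot> i) = (j' \<cdot> p) \<cdot> i" using comp_assoc[OF pa(1) a(2,4)] a(5) by simp
    also have "\<dots> = zerom C A R" using comp_zeroR[OF pa(3,1,2) a(3)] .
    finally show "p' \<cdot> (j \<cdot> i) = zerom C A R" .
    show "epic C D p' R"
    proof (rule epicI[OF a(4)])
      fix W g h assume g: "arr C R g W" and h: "arr C R h W" and eq: "g \<cdot> p' = h \<cdot> p'"
      have "(g \<cdot> j') \<cdot> p = (g \<cdot> p') \<cdot> j" using comp_assoc[OF a(1,3) g] comp_assoc[OF a(2,4) g] a(5) by simp
      also have "\<dots> = (h \<cdot> j') \<cdot> p"
        using eq comp_assoc[OF a(1,3) h] comp_assoc[OF a(2,4) h] a(5) by simp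
      finally have "g \<cdot> j' = h \<cdot> j'"
        by (rule epicD[OF cokernel_epic[OF p] comp_arr[OF a(3) g] comp_arr[OF a(3) h]])
      then show "g = h" by (rule pushout_unique[OF P g h _ eq])
    qed
    fix W h assume h: "arr C D h W" "h \<cdot> (j \<cdot> i) = zerom C A W"
    then have "(h \<cdot> j) \<cdot> i = zerom C A W" using comp_assoc[OF pa(1) a(2) h(1)] by simp
    then obtain k where k: "arr C N k W" "k \<cdot> p = h \<cdot> j"
      using cokernel_factor[OF p comp_arr[OF a(2) h(1)]] by blast
    then show "\<exists>k. arr C R k W \<and> k \<cdot> p' = h" using pushout_factor[OF P k(1) h(1) k(2)] by blast
  qed
qed

end

section \<open>Images, short exact sequences and pushouts of monomorphisms\<close>

context abelian_category
begin

text \<open>The map \<open>g\<close> of which \<open>f\<close> is a kernel factors through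
  \<open>p\<close>, so everything killed by \<open>p\<close> is killed by \<open>g\<close> and lifts
  to \<open>X\<close>.\<close>

lemma monic_kernel_of_cokernel:
  assumes m: "monic C X f Y" and p: "is_cokernel C X f Y p N"
  shows "is_kernel C X f Y p N"
proof -
  obtain Z g where g: "is_kernel C X f Y g Z" using monic_is_kernel[OF m] by blast
  note ga = kernel_arr[OF g] and pa = cokernel_arr[OF p]
  obtain g' where g': "arr C N g' Z" "g' \<cdot> p = g" using cokernel_factor[OF p ga(2,3)] .
  show ?thesis
  proof (rule is_kernelI[OF pa(2,3) m])
    fix W x assume x: "arr C W x Y" "p \<cdot> x = zerom C W N"
    then have "g \<cdot> x = zerom C W Z" using comp_zeroR[OF x(2,1) pa(2) g'(1)] g'(2) by simp
    then show "\<exists>h. arr C W h X \<and> f \<cdot> h = x" using kernel_factor[OF g x(1)] by blast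
  qed
qed

lemma epic_cokernel_of_kernel:
  assumes e: "epic C X f Y" and k: "is_kernel C K k X f Y"
  shows "is_cokernel C K k X f Y"
proof -
  obtain Z g where g: "is_cokernel C Z g X f Y" using epic_is_cokernel[OF e] by blast
  note ga = cokernel_arr[OF g] and ka = kernel_arr[OF k]
  obtain g' where g': "arr C Z g' K" "k \<cdot> g' = g" using kernel_factor[OF k ga(1,3)] .
  show ?thesis
  proof (rule is_cokernelI[OF ka(1,3) e])
    fix W x assume x: "arr C X x W" "x \<cdot> k = zerom C K W"
    then have "x \<cdot> g = zerom C Z W" using comp_zeroL[OF x(2) g'(1) ka(1) x(1)] g'(2) by simp
    then show "\<exists>h. arr C Y h W \<and> h \<cdot> f = x" using cokernel_factor[OF g x(1)] by blast
  qed
qed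

lemma kernelE:
  assumes "arr C X f Y"
  obtains K k where "is_kernel C K k X f Y"
  using assms ex_kernel unfolding arr_def by blast

lemma cokernelE:
  assumes "arr C X f Y"
  obtains N p where "is_cokernel C X f Y p N"
  using assms ex_cokernel unfolding arr_def by blast

text \<open>The image is taken as the kernel \<open>i\<close> of the cokernel of \<open>f\<close>;
  the work lies in showing that the induced \<open>q\<close> is epic.\<close>

lemma ex_image_factorization:
  assumes f: "arr C X f Y"
  shows "\<exists>J q i. image_factorization C X f Y J q i"
proof -
  obtain N p where p: "is_cokernel C X f Y p N" using cokernelE[OF f] .
  note pa = cokernel_arr[OF p]
  obtain J i where i: "is_kernel C J i Y p N" using kernelE[OF pa(2)] .
  note ia = kernel_arr[OF i]
  obtain q where q: "arr C X q J" "i \<cdot> q = f" using kernel_factor[OF i f pa(3)] .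
  have "epic C X q J"
  proof (rule epic_zeroI[OF q(1)])
    fix W z assume z: "arr C J z W" "z \<cdot> q = zerom C X W"
    \<comment> \<open>If \<open>z\<close> kills \<open>q\<close>, then \<open>q\<close>, and hence
      \<open>f\<close>, factors through the kernel \<open>K\<close> of \<open>z\<close>. The
      cokernel \<open>r\<close> of the inclusion of \<open>K\<close> in \<open>Y\<close> kills
      \<open>f\<close>, hence factors through \<open>p\<close> and kills \<open>i\<close>. So
      \<open>i\<close> factors through \<open>K\<close> in turn, the inclusion \<open>k\<close> has
      a right inverse, and \<open>z = 0\<close>.\<close>
    obtain K k where k: "is_kernel C K k J z W" using kernelE[OF z(1)] .
    note ka = kernel_arr[OF k]
    obtain q' where q': "arr C X q' K" "k \<cdot> q' = q" using kernel_factor[OF k q(1) z(2)] .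
    have ik: "monic C K (i \<cdot> k) Y" by (rule monic_comp[OF kernel_monic[OF k] kernel_monic[OF i]])
    note ika = monic_arr[OF ik]
    obtain R r where r: "is_cokernel C K (i \<cdot> k) Y r R" using cokernelE[OF ika] .
    note ra = cokernel_arr[OF r]
    have "f = (i \<cdot> k) \<cdot> q'" using comp_assoc[OF q'(1) ka(1) ia(1)] q'(2) q(2) by simp
    then have "r \<cdot> f = zerom C X R" using comp_zeroL[OF ra(3) q'(1) ra(1,2)] by simp
    then obtain r' where r': "arr C N r' R" "r' \<cdot> p = r" using cokernel_factor[OF p ra(2)] by blast
    have "r \<cdot> i = zerom C J R" using comp_zeroR[OF ia(3,1,2) r'(1)] r'(2) by simp
    then obtain s where s: "arr C J s K" "(i \<cdot> k) \<cdot> s = i"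
      using kernel_factor[OF monic_kernel_of_cokernel[OF ik r] ia(1)] by blast
    have J: "J \<in> obj C" using arr_obj[OF s(1)] by simp
    have "i \<cdot> (k \<cdot> s) = i \<cdot> idm C J" using comp_assoc[OF s(1) ka(1) ia(1)] s(2) comp_id_right[OF ia(1)] by simp
    then have "k \<cdot> s = idm C J"
      by (rule monicD[OF kernel_monic[OF i] comp_arr[OF s(1) ka(1)] id_arr[OF J]])
    then show "z = zerom C J W"
      using comp_zeroL[OF ka(3) s(1) ka(1,2)] comp_id_right[OF z(1)] by simp
  qed
  then show ?thesis using kernel_monic[OF i] q f unfolding image_factorization_def arr_def by blast
qed

text \<open>The monic \<open>f\<close> is a kernel of some \<open>h\<close>, and epicity forces
  \<open>h = 0\<close>. The identity of \<open>Y\<close> then factors through \<open>f\<close>,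
  which gives the inverse.\<close>

lemma monic_epic_iso:
  assumes m: "monic C X f Y" and e: "epic C X f Y"
  obtains g where "arr C Y g X" "g \<cdot> f = idm C X" "f \<cdot> g = idm C Y"
proof -
  note f = monic_arr[OF m]
  have obs: "X \<in> obj C" "Y \<in> obj C" using arr_obj[OF f] .
  obtain Z h where h: "is_kernel C X f Y h Z" using monic_is_kernel[OF m] by blast
  note ha = kernel_arr[OF h]
  have "h = zerom C Y Z" by (rule epic_zeroD[OF e ha(2,3)])
  then have "h \<cdot> idm C Y = zerom C Y Z" using comp_id_right[OF ha(2)] by simp
  then obtain g where g: "arr C Y g X" "f \<cdot> g = idm C Y" using kernel_factor[OF h id_arr[OF obs(2)]] by blast
  have "f \<cdot> (g \<cdot> f) = f \<cdot> idm C X"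
    using comp_assoc[OF f g(1) f] g(2) comp_id_left[OF f] comp_id_right[OF f] by simp
  then have "g \<cdot> f = idm C X" by (rule monicD[OF m comp_arr[OF f g(1)] id_arr[OF obs(1)]])
  then show thesis using that g by blast
qed

lemma short_exactI:
  assumes m: "monic C X f Y" and p: "is_cokernel C X f Y g Z"
  shows "short_exact C X f Y g Z"
proof -
  note f = monic_arr[OF m]
  have "image_factorization C X f Y X (idm C X) f"
    using m epic_id arr_obj(1)[OF f] comp_id_right[OF f] f
    unfolding image_factorization_def arr_def by auto
  then show ?thesis
    using m monic_kernel_of_cokernel[OF m p] cokernel_epic[OF p]
    unfolding short_exact_def exact_at_def by blast
qed

text \<open>Exactness only says that the image \<open>i\<close> of \<open>f\<close> is a kernel of
  \<open>g\<close>. With \<open>f\<close> monic, the epic part \<open>q\<close> of its factorization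
  is also monic, hence invertible, so \<open>f\<close> itself is that kernel.\<close>

lemma short_exactD:
  assumes S: "short_exact C X f Y g Z"
  shows "monic C X f Y" "is_kernel C X f Y g Z" "is_cokernel C X f Y g Z" "epic C Y g Z"
proof -
  show m: "monic C X f Y" and e: "epic C Y g Z" using S unfolding short_exact_def by auto
  obtain J q i where J: "image_factorization C X f Y J q i" and i: "is_kernel C J i Y g Z"
    using S unfolding short_exact_def exact_at_def by blast
  have q: "epic C X q J" and f: "f = i \<cdot> q" using J unfolding image_factorization_def by auto
  note qa = epic_arr[OF q] and ia = kernel_arr[OF i]
  have "monic C X q J" using monic_cancel[OF _ qa ia(1)] m f by simp
  then obtain r where r: "arr C J r X" "q \<cdot> r = idm C J" using monic_epic_iso[OF _ q] by metis
  show k: "is_kernel C X f Y g Z"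
  proof (rule is_kernelI[OF ia(2) _ m])
    show "g \<cdot> f = zerom C X Z" using comp_zeroL[OF ia(3) qa ia(1,2)] f by simp
    fix W x assume x: "arr C W x Y" "g \<cdot> x = zerom C W Z"
    then obtain h where h: "arr C W h J" "i \<cdot> h = x" using kernel_factor[OF i] by blast
    have "f \<cdot> (r \<cdot> h) = i \<cdot> (q \<cdot> (r \<cdot> h))"
      using f comp_assoc[OF comp_arr[OF h(1) r(1)] qa ia(1)] by simp
    also have "\<dots> = x" using comp_eq_left[OF h(1) r(1) qa r(2)] comp_id_left[OF h(1)] h(2) by simp
    finally show "\<exists>h. arr C W h X \<and> f \<cdot> h = x" using comp_arr[OF h(1) r(1)] by blast
  qed
  show "is_cokernel C X f Y g Z" by (rule epic_cokernel_of_kernel[OF e k])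
qed

text \<open>The pushout is the cokernel \<open>c\<close> of the map \<open>d\<close> from
  \<open>A\<close> to the biproduct with components \<open>f\<close> and \<open>-g\<close>. As
  \<open>p \<cdot> d = f\<close> is monic, so is \<open>d\<close>, which makes \<open>d\<close> the
  kernel of \<open>c\<close>. Whatever \<open>f'\<close> kills thus comes from \<open>A\<close>,
  where \<open>f\<close> kills it.\<close>

lemma ex_pushout_monic:
  assumes m: "monic C A f B" and g: "arr C A g X"
  obtains P g' f' where "is_pushout C A f B g X P g' f'" "monic C X f' P"
proof -
  note f = monic_arr[OF m]
  have obs: "A \<in> obj C" "B \<in> obj C" "X \<in> obj C" using arr_obj[OF f] arr_obj[OF g] by auto
  obtain S i j p q where S: "biproduct C B X S i j p q" using ex_biproduct[OF obs(2,3)] by blast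
  have i: "arr C B i S" and j: "arr C X j S" and p: "arr C S p B" and q: "arr C S q X"
    and pi: "p \<cdot> i = idm C B" and qj: "q \<cdot> j = idm C X" and pj: "p \<cdot> j = zerom C X B"
    and qi: "q \<cdot> i = zerom C B X" and ipjq: "addm C (i \<cdot> p) (j \<cdot> q) = idm C S"
    using S by (auto simp: biproduct_def arr_def)
  have So: "S \<in> obj C" using arr_obj[OF i] by simp
  \<comment> \<open>\<open>d = i f - j g\<close>, written so as to avoid negation\<close>
  obtain d where d: "arr C A d S" "addm C d (j \<cdot> g) = i \<cdot> f"
    using ex_difference[OF comp_arr[OF f i] comp_arr[OF g j]] .
  obtain P c where c: "is_cokernel C A d S c P" using cokernelE[OF d(1)] .
  note ca = cokernel_arr[OF c]
  have gc: "arr C B (c \<cdot> i) P" and fc: "arr C X (c \<cdot> j) P"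
    using comp_arr[OF i ca(2)] comp_arr[OF j ca(2)] .
  \<comment> \<open>Commuting squares under \<open>f\<close> and \<open>g\<close> correspond to maps
    on the biproduct that kill \<open>d\<close>.\<close>
  have rel: "(x \<cdot> i) \<cdot> f = (x \<cdot> j) \<cdot> g \<longleftrightarrow> x \<cdot> d = zerom C A W" if x: "arr C S x W" for x W
  proof -
    have eq: "addm C (x \<cdot> d) ((x \<cdot> j) \<cdot> g) = (x \<cdot> i) \<cdot> f"
      using comp_add_right[OF d(1) comp_arr[OF g j] x] d(2) comp_assoc[OF f i x]
        comp_assoc[OF g j x] by simp
    show ?thesis
      using add_eq_self[OF comp_arr[OF d(1) x] comp_arr[OF g comp_arr[OF j x]]]
        add_zero[OF comp_arr[OF g comp_arr[OF j x]]] eq by auto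
  qed
  have split: "addm C ((x \<cdot> i) \<cdot> p) ((x \<cdot> j) \<cdot> q) = x" if x: "arr C S x W" for x W
    using comp_add_right[OF comp_arr[OF p i] comp_arr[OF q j] x] ipjq comp_id_right[OF x]
      comp_assoc[OF p i x] comp_assoc[OF q j x] by simp
  have P: "is_pushout C A f B g X P (c \<cdot> i) (c \<cdot> j)"
    unfolding is_pushout_def
  proof (intro conjI allI impI f g gc fc)
    show "(c \<cdot> i) \<cdot> f = (c \<cdot> j) \<cdot> g" using rel[OF ca(2)] ca(3) by simp
    fix W x y assume *: "arr C B x W \<and> arr C X y W \<and> x \<cdot> f = y \<cdot> g"
    then have x: "arr C B x W" and y: "arr C X y W" and eq: "x \<cdot> f = y \<cdot> g" by auto
    have W: "W \<in> obj C" using arr_obj[OF x] by simp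
    \<comment> \<open>The map on the biproduct with components \<open>x\<close> and
      \<open>y\<close>.\<close>
    define z where "z = addm C (x \<cdot> p) (y \<cdot> q)"
    note xp = comp_arr[OF p x] and yq = comp_arr[OF q y]
    have z: "arr C S z W" unfolding z_def by (rule add_arr[OF xp yq])
    have zi: "z \<cdot> i = x"
      unfolding z_def comp_add_left[OF i xp yq]
      using comp_eq_right[OF i p x pi] comp_zeroR[OF qi i q y] comp_id_right[OF x] add_zero[OF x] by simp
    have zj: "z \<cdot> j = y"
      unfolding z_def comp_add_left[OF j xp yq]
      using comp_eq_right[OF j q y qj] comp_zeroR[OF pj j p x] comp_id_right[OF y] add_zero[OF y] by simp
    have "z \<cdot> d = zerom C A W" using rel[OF z] zi zj eq by simp
    then obtain h where h: "arr C P h W" "h \<cdot> c = z" using cokernel_factor[OF c z] by blast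
    show "\<exists>!h. arr C P h W \<and> h \<cdot> (c \<cdot> i) = x \<and> h \<cdot> (c \<cdot> j) = y"
    proof (rule ex1I)
      show "arr C P h W \<and> h \<cdot> (c \<cdot> i) = x \<and> h \<cdot> (c \<cdot> j) = y"
        using h comp_assoc[OF i ca(2) h(1)] comp_assoc[OF j ca(2) h(1)] zi zj by simp
      fix k assume k: "arr C P k W \<and> k \<cdot> (c \<cdot> i) = x \<and> k \<cdot> (c \<cdot> j) = y"
      then have ka: "arr C P k W" by simp
      have "k \<cdot> c = z"
        using split[OF comp_arr[OF ca(2) ka]] k comp_assoc[OF i ca(2) ka] comp_assoc[OF j ca(2) ka]
        by (simp add: z_def)
      then show "k = h" using epicD[OF cokernel_epic[OF c] ka h(1)] h(2) by simp
    qed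
  qed
  have pd: "p \<cdot> d = f"
  proof -
    have "addm C (p \<cdot> d) (p \<cdot> (j \<cdot> g)) = p \<cdot> (i \<cdot> f)"
      using comp_add_right[OF d(1) comp_arr[OF g j] p] d(2) by simp
    then show ?thesis
      using comp_zeroL[OF pj g j p] comp_eq_left[OF f i p pi] comp_id_left[OF f]
        add_zero[OF comp_arr[OF d(1) p]] by simp
  qed
  have dm: "monic C A d S" using monic_cancel[OF _ d(1) p] pd m by simp
  have "monic C X (c \<cdot> j) P"
  proof (rule monic_zeroI[OF fc])
    fix W z assume z: "arr C W z X" "(c \<cdot> j) \<cdot> z = zerom C W P"
    note jz = comp_arr[OF z(1) j]
    have "c \<cdot> (j \<cdot> z) = zerom C W P" using z(2) comp_assoc[OF z(1) j ca(2)] by simp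
    then obtain w where w: "arr C W w A" "d \<cdot> w = j \<cdot> z"
      using kernel_factor[OF monic_kernel_of_cokernel[OF dm c] jz] by blast
    have "f \<cdot> w = p \<cdot> (d \<cdot> w)" using comp_assoc[OF w(1) d(1) p] pd by simp
    then have "f \<cdot> w = zerom C W B" using w(2) comp_zeroL[OF pj z(1) j p] by simp
    then have "w = zerom C W A" using monic_zeroD[OF m w(1)] by simp
    then have "j \<cdot> z = zerom C W S" using w comp_zero_right[OF d(1)] arr_obj[OF z(1)] by simp
    then have "q \<cdot> (j \<cdot> z) = zerom C W X" using comp_zero_right[OF q] arr_obj[OF z(1)] by simp
    then show "z = zerom C W X" using comp_eq_left[OF z(1) j q qj] comp_id_left[OF z(1)] by simp
  qed
  then show thesis using that P by blast
qed

text \<open>An arbitrary pushout maps to the one just constructed, and following \<open>f'\<close>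
  by this map gives a monic.\<close>

lemma pushout_monic:
  assumes P: "is_pushout C A f B g X P g' f'" and m: "monic C A f B"
  shows "monic C X f' P"
proof -
  note a = is_pushoutD[OF P]
  obtain R u v where R: "is_pushout C A f B g X R u v" "monic C X v R"
    using ex_pushout_monic[OF m a(2)] .
  note b = is_pushoutD[OF R(1)]
  obtain h where h: "arr C P h R" "h \<cdot> f' = v" using pushout_factor[OF P b(3-5)] .
  show ?thesis using monic_cancel[OF _ a(4) h(1)] h(2) R(2) by simp
qed

lemma pushout_short_exact:
  assumes P: "is_pushout C A f B g X P g' f'" and S: "short_exact C A f B p N"
  obtains p' where "short_exact C X f' P p' N" "p' \<cdot> g' = p"
  using pushout_cokernel[OF P short_exactD(3)[OF S]]
    short_exactI[OF pushout_monic[OF P short_exactD(1)[OF S]]] by metis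

text \<open>The short five lemma with identities on the outer terms. Elements are replaced by
  morphisms into \<open>R\<close> for injectivity and out of \<open>Y\<close> for
  surjectivity.\<close>

lemma short_five:
  assumes R: "short_exact C X f R r Q" and Y: "short_exact C X x Y y Q"
    and h: "arr C R h Y" and hf: "h \<cdot> f = x" and yh: "y \<cdot> h = r"
  shows "monic C R h Y" "epic C R h Y"
proof -
  note ra = kernel_arr[OF short_exactD(2)[OF R]] and ya = kernel_arr[OF short_exactD(2)[OF Y]]
  show "monic C R h Y"
  proof (rule monic_zeroI[OF h])
    fix W z assume z: "arr C W z R" "h \<cdot> z = zerom C W Y"
    have W: "W \<in> obj C" using arr_obj[OF z(1)] by simp
    have "r \<cdot> z = zerom C W Q" using comp_zeroR[OF z(2,1) h ya(2)] yh by simp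
    then obtain w where w: "arr C W w X" "f \<cdot> w = z"
      using kernel_factor[OF short_exactD(2)[OF R] z(1)] by blast
    have "x \<cdot> w = zerom C W Y" using comp_assoc[OF w(1) ra(1) h] w(2) hf z(2) by simp
    then have "w = zerom C W X" by (rule monic_zeroD[OF short_exactD(1)[OF Y] w(1)])
    then show "z = zerom C W R" using w comp_zero_right[OF ra(1) W] by simp
  qed
  show "epic C R h Y"
  proof (rule epic_zeroI[OF h])
    fix W z assume z: "arr C Y z W" "z \<cdot> h = zerom C R W"
    have W: "W \<in> obj C" using arr_obj[OF z(1)] by simp
    have "z \<cdot> x = zerom C X W" using comp_zeroL[OF z(2) ra(1) h z(1)] hf by simp
    then obtain w where w: "arr C Q w W" "w \<cdot> y = z"
      using cokernel_factor[OF short_exactD(3)[OF Y] z(1)] by blast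
    have "w \<cdot> r = zerom C R W" using comp_assoc[OF h ya(2) w(1)] w(2) yh z(2) by simp
    then have "w = zerom C Q W" by (rule epic_zeroD[OF short_exactD(4)[OF R] w(1)])
    then show "z = zerom C Y W" using w comp_zero_left[OF ya(2) W] by simp
  qed
qed

lemma cokernel_comp_iso:
  assumes p: "is_cokernel C X f Y p N" and h: "arr C N h M" "monic C N h M" "epic C N h M"
  shows "is_cokernel C X f Y (h \<cdot> p) M"
proof -
  note pa = cokernel_arr[OF p]
  obtain g where g: "arr C M g N" "g \<cdot> h = idm C N" using monic_epic_iso[OF h(2,3)] by metis
  show ?thesis
  proof (rule is_cokernelI[OF pa(1)])
    show "(h \<cdot> p) \<cdot> f = zerom C X M" by (rule comp_zeroR[OF pa(3,1,2) h(1)])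
    show "epic C Y (h \<cdot> p) M"
    proof (rule epicI[OF comp_arr[OF pa(2) h(1)]])
      fix W u v assume u: "arr C M u W" and v: "arr C M v W" and eq: "u \<cdot> (h \<cdot> p) = v \<cdot> (h \<cdot> p)"
      then have "(u \<cdot> h) \<cdot> p = (v \<cdot> h) \<cdot> p"
        using comp_assoc[OF pa(2) h(1) u] comp_assoc[OF pa(2) h(1) v] by simp
      then have "u \<cdot> h = v \<cdot> h"
        by (rule epicD[OF cokernel_epic[OF p] comp_arr[OF h(1) u] comp_arr[OF h(1) v]])
      then show "u = v" by (rule epicD[OF h(3) u v])
    qed
    fix W x assume x: "arr C Y x W" "x \<cdot> f = zerom C X W"
    then obtain w where w: "arr C N w W" "w \<cdot> p = x" using cokernel_factor[OF p] by blast
    have "(w \<cdot> g) \<cdot> (h \<cdot> p) = ((w \<cdot> g) \<cdot> h) \<cdot> p"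
      by (rule comp_assoc[OF pa(2) h(1) comp_arr[OF g(1) w(1)]])
    also have "\<dots> = x" using comp_eq_right[OF h(1) g(1) w(1) g(2)] comp_id_right[OF w(1)] w(2) by simp
    finally show "\<exists>k. arr C M k W \<and> k \<cdot> (h \<cdot> p) = x" using comp_arr[OF g(1) w(1)] by blast
  qed
qed

end

section \<open>Lifting extensions along syzygies\<close>

text \<open>In a trivial quotient every coset is \<open>H\<close>, and \<open>a\<close> lies in its
  own coset because the neutral element lies in \<open>H\<close>. Stated so as to apply directly to
  cocycles modulo coboundaries.\<close>

lemma trivial_Mod_eq:
  assumes "trivial_group (G Mod H)" and "a \<in> carrier G" "\<one>\<^bsub>G\<^esub> \<in> H" "\<one>\<^bsub>G\<^esub> \<otimes>\<^bsub>G\<^esub> a = a"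
  shows "a \<in> H"
proof -
  have "H #>\<^bsub>G\<^esub> a \<in> carrier (G Mod H)" using assms(2) by (auto simp: FactGroup_def RCOSETS_def)
  then have "H #>\<^bsub>G\<^esub> a = H" using assms(1) by (auto simp: trivial_group_def FactGroup_def)
  moreover have "a \<in> H #>\<^bsub>G\<^esub> a" using assms(3,4) unfolding r_coset_def by force
  ultimately show ?thesis by simp
qed

context preadditive_category
begin

text \<open>Serves to compute the kernel of a differential, which is a projective cover map followed
  by the inclusion of a syzygy.\<close>

lemma kernel_comp_monic:
  assumes k: "is_kernel C K k X f Y" and m: "monic C Y m Z"
  shows "is_kernel C K k X (m \<cdot> f) Z"
proof (rule is_kernelI)
  note ka = kernel_arr[OF k] and ma = monic_arr[OF m]
  show "arr C X (m \<cdot> f) Z" by (rule comp_arr[OF ka(2) ma])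
  show "(m \<cdot> f) \<cdot> k = zerom C K Z" by (rule comp_zeroR[OF ka(3,1,2) ma])
  show "monic C K k X" by (rule kernel_monic[OF k])
  fix W g assume g: "arr C W g X" "(m \<cdot> f) \<cdot> g = zerom C W Z"
  then have "m \<cdot> (f \<cdot> g) = zerom C W Z" using comp_assoc[OF g(1) ka(2) ma] by simp
  then have "f \<cdot> g = zerom C W Y" by (rule monic_zeroD[OF m comp_arr[OF g(1) ka(2)]])
  then show "\<exists>h. arr C W h K \<and> k \<cdot> h = g" using kernel_factor[OF k g(1)] by blast
qed

end

lemma exact_atI:
  assumes "epic C X q J" "is_kernel C J i Y g Z" "monic C J i Y" "arr C X (i \<cdot>\<^bsub>C\<^esub> q) Y"
  shows "exact_at C X (i \<cdot>\<^bsub>C\<^esub> q) Y g Z"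
  using assms unfolding exact_at_def image_factorization_def arr_def by blast

lemma exact_atE:
  assumes "exact_at C X f Y g Z"
  obtains J q i where "epic C X q J" "monic C J i Y" "f = i \<cdot>\<^bsub>C\<^esub> q" "is_kernel C J i Y g Z"
  using assms unfolding exact_at_def image_factorization_def by blast

context abelian_category
begin

text \<open>Iterated syzygies: cover an object by a projective, take the kernel, repeat. Existence
  guarantees that the \<open>SOME\<close> inside \<open>Ext\<close> denotes an actual
  resolution.\<close>

lemma ex_projective_resolution:
  assumes "enough_projectives C" and X: "X \<in> obj C"
  shows "\<exists>P d e. projective_resolution C X P d e"
proof -
  have "\<forall>K. \<exists>P e L k. K \<in> obj C \<longrightarrow> projective C P \<and> epic C P e K \<and> is_kernel C L k P e K"
    using assms kernelE epic_arr unfolding enough_projectives_def by meson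
  then obtain P e L k where *: "\<And>K. K \<in> obj C \<Longrightarrow>
      projective C (P K) \<and> epic C (P K) (e K) K \<and> is_kernel C (L K) (k K) (P K) (e K) K"
    by metis
  \<comment> \<open>\<open>N n\<close> is the n-th syzygy of \<open>X\<close>. Below,
    \<open>d n\<close> covers \<open>N (Suc n)\<close> by its projective and then includes it in the
    projective over \<open>N n\<close>.\<close>
  define N where "N n = (L ^^ n) X" for n
  have N0: "N 0 = X" and NS: "N (Suc n) = L (N n)" for n by (auto simp: N_def)
  have N: "N n \<in> obj C" for n
  proof (induction n)
    case (Suc n)
    then show ?case using *[of "N n"] kernel_arr(1) arr_obj(1) NS by metis
  qed (simp add: N0 X)
  have pr: "projective C (P (N n))" and ep: "epic C (P (N n)) (e (N n)) (N n)"
    and ke: "is_kernel C (N (Suc n)) (k (N n)) (P (N n)) (e (N n)) (N n)" for n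
    using *[OF N[of n]] by (auto simp: NS)
  define d where "d n = k (N n) \<cdot> e (N (Suc n))" for n
  have ar: "arr C (P (N (Suc n))) (k (N n) \<cdot> e (N (Suc n))) (P (N n))" for n
    by (rule comp_arr[OF epic_arr[OF ep] kernel_arr(1)[OF ke]])
  have "exact_at C (P (N (Suc 0))) (d 0) (P (N 0)) (e (N 0)) X"
    unfolding d_def using exact_atI[OF ep ke kernel_monic[OF ke] ar, of 0] by (simp add: N0)
  moreover have "exact_at C (P (N (Suc (Suc n)))) (d (Suc n)) (P (N (Suc n))) (d n) (P (N n))" for n
    unfolding d_def
    by (rule exact_atI[OF ep kernel_comp_monic[OF ke kernel_monic[OF ke]] kernel_monic[OF ke] ar])
  ultimately have "projective_resolution C X (\<lambda>n. P (N n)) d (e (N 0))"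
    using pr ep[of 0] unfolding projective_resolution_def by (simp add: N0)
  then show ?thesis by blast
qed

text \<open>Unpacks \<open>Ext\<close> for the very resolution it chooses: every 2-cocycle with
  values in \<open>Y\<close> is a coboundary.\<close>

lemma Ext_2_trivialE:
  assumes "enough_projectives C" and X: "X \<in> obj C" and Y: "Y \<in> obj C"
    and tr: "trivial_group (Ext C 2 X Y)"
  obtains P d e where "projective_resolution C X P d e"
    and "\<forall>a. arr C (P 2) a Y \<and> a \<cdot> d 2 = zerom C (P 3) Y \<longrightarrow>
      (\<exists>b. arr C (P 1) b Y \<and> b \<cdot> d 1 = a)"
proof -
  define R where "R = (SOME (P, d, e). projective_resolution C X P d e)"
  obtain P d e where R: "R = (P, d, e)" by (cases R)
  have "\<exists>R. case R of (P, d, e) \<Rightarrow> projective_resolution C X P d e"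
    using ex_projective_resolution[OF assms(1) X] by auto
  then have "case R of (P, d, e) \<Rightarrow> projective_resolution C X P d e"
    unfolding R_def by (rule someI_ex)
  then have res: "projective_resolution C X P d e" using R by simp
  define G where "G = (hom_group C (P 2) Y)\<lparr>carrier := cocycles C P d Y 2\<rparr>"
  have tr': "trivial_group (G Mod coboundaries C P d Y 2)"
    using tr unfolding Ext_def R_def[symmetric] R G_def by simp
  have "exact_at C (P 2) (d 1) (P 1) (d 0) (P 0)"
    using res unfolding projective_resolution_def by (simp add: numeral_2_eq_2)
  then have d1: "arr C (P 2) (d 1) (P 1)"
    unfolding exact_at_def image_factorization_def epic_def monic_def arr_def by blast
  note z = zero_arr[OF arr_obj(2)[OF d1] Y]
  have "\<exists>b. arr C (P 1) b Y \<and> b \<cdot> d 1 = a"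
    if a: "arr C (P 2) a Y" "a \<cdot> d 2 = zerom C (P 3) Y" for a
  proof -
    have "a \<in> coboundaries C P d Y 2"
    proof (rule trivial_Mod_eq[OF tr'])
      show "a \<in> carrier G" using a by (simp add: G_def cocycles_def arr_def)
      have "zerom C (P 2) Y = zerom C (P 1) Y \<cdot> d 1" using comp_zero_left[OF d1 Y] by simp
      then show "\<one>\<^bsub>G\<^esub> \<in> coboundaries C P d Y 2"
        using z by (auto simp: G_def hom_group_def numeral_2_eq_2 arr_def)
      show "\<one>\<^bsub>G\<^esub> \<otimes>\<^bsub>G\<^esub> a = a" using add_zero(2)[OF a(1)] by (simp add: G_def hom_group_def)
    qed
    then show ?thesis using arr_obj(2)[OF d1] Y by (auto simp: numeral_2_eq_2 arr_def)
  qed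
  then show thesis using that res by blast
qed

text \<open>Vanishing of \<open>Ext\<^sup>2(Q, N)\<close> as vanishing of \<open>Ext\<^sup>1(K, N)\<close> for a first syzygy \<open>K\<close> of \<open>Q\<close>.\<close>

lemma syzygy_lifting:
  assumes "enough_projectives C" and tr: "trivial_group (Ext C 2 Q N)" and Q: "Q \<in> obj C"
    and S: "short_exact C N \<iota> E \<pi> M"
  obtains K k P e where "short_exact C K k P e Q" "projective C P"
    and "\<forall>t. arr C K t M \<longrightarrow> (\<exists>t'. arr C K t' E \<and> \<pi> \<cdot> t' = t)"
proof -
  note \<iota> = kernel_arr(1)[OF short_exactD(2)[OF S]] and \<pi> = kernel_arr(2)[OF short_exactD(2)[OF S]]
    and \<pi>\<iota> = kernel_arr(3)[OF short_exactD(2)[OF S]]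
  obtain P d e where res: "projective_resolution C Q P d e"
    and ext: "\<forall>a. arr C (P 2) a N \<and> a \<cdot> d 2 = zerom C (P 3) N \<longrightarrow>
      (\<exists>b. arr C (P 1) b N \<and> b \<cdot> d 1 = a)"
    using Ext_2_trivialE[OF assms(1) Q arr_obj(1)[OF \<iota>] tr] .
  have pr: "projective C (P n)" for n using res unfolding projective_resolution_def by simp
  have e: "epic C (P 0) e Q" using res unfolding projective_resolution_def by simp
  have "exact_at C (P 1) (d 0) (P 0) e Q"
    using res unfolding projective_resolution_def by simp
  \<comment> \<open>\<open>K\<close> is the first syzygy, the image of \<open>d 0\<close>, and
    \<open>K2\<close> below is the second one, the kernel of \<open>d 0\<close>.\<close>
  then obtain K q k where q: "epic C (P 1) q K" and d0: "d 0 = k \<cdot> q"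
    and k: "is_kernel C K k (P 0) e Q" using exact_atE by metis
  have "exact_at C (P 2) (d 1) (P 1) (d 0) (P 0)"
    using res unfolding projective_resolution_def by (simp add: numeral_2_eq_2)
  then obtain K2 q2 k2 where q2: "epic C (P 2) q2 K2" and d1: "d 1 = k2 \<cdot> q2"
    and k2: "is_kernel C K2 k2 (P 1) (d 0) (P 0)" using exact_atE by metis
  have "exact_at C (P (Suc 2)) (d (Suc 1)) (P (Suc 1)) (d 1) (P 1)"
    using res unfolding projective_resolution_def by (simp add: numeral_2_eq_2)
  then have "exact_at C (P 3) (d 2) (P 2) (d 1) (P 1)" by (simp add: numeral_3_eq_3 numeral_2_eq_2)
  then obtain K3 q3 k3 where q3: "epic C (P 3) q3 K3" and d2: "d 2 = k3 \<cdot> q3"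
    and k3: "is_kernel C K3 k3 (P 2) (d 1) (P 1)" using exact_atE by metis
  note qa = epic_arr[OF q] and q2a = epic_arr[OF q2] and q3a = epic_arr[OF q3]
    and ka = kernel_arr[OF k] and k2a = kernel_arr[OF k2] and k3a = kernel_arr[OF k3]
  have d2a: "arr C (P 3) (d 2) (P 2)" using comp_arr[OF q3a k3a(1)] d2 by simp
  have d12: "d 1 \<cdot> d 2 = zerom C (P 3) (P 1)" using comp_zeroL[OF k3a(3) q3a k3a(1,2)] d2 by simp
  have km: "monic C K k (P 0)" by (rule kernel_monic[OF k])
  \<comment> \<open>Since \<open>k\<close> is monic, \<open>q\<close> has the same kernel
    \<open>k2\<close> as \<open>d 0 = k \<cdot> q\<close>. Being epic, \<open>q\<close> is then the
    cokernel of \<open>k2\<close>, so a map on \<open>P 1\<close> descends to \<open>K\<close> once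
    it kills \<open>k2\<close>.\<close>
  have "k \<cdot> (q \<cdot> k2) = zerom C K2 (P 0)" using comp_assoc[OF k2a(1) qa ka(1)] k2a(3) d0 by simp
  then have qk2: "q \<cdot> k2 = zerom C K2 K" by (rule monic_zeroD[OF km comp_arr[OF k2a(1) qa]])
  have "is_kernel C K2 k2 (P 1) q K"
  proof (rule is_kernelI[OF qa qk2 kernel_monic[OF k2]])
    fix W g assume g: "arr C W g (P 1)" "q \<cdot> g = zerom C W K"
    have "d 0 \<cdot> g = zerom C W (P 0)" using comp_zeroR[OF g(2,1) qa ka(1)] d0 by simp
    then show "\<exists>h. arr C W h K2 \<and> k2 \<cdot> h = g" using kernel_factor[OF k2 g(1)] by blast
  qed
  then have qc: "is_cokernel C K2 k2 (P 1) q K" by (rule epic_cokernel_of_kernel[OF q])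
  have "\<exists>t'. arr C K t' E \<and> \<pi> \<cdot> t' = t" if t: "arr C K t M" for t
  proof -
    \<comment> \<open>By projectivity \<open>t \<cdot> q\<close> lifts along \<pi> to some
      \<open>b\<close>. The obstruction to descending \<open>b\<close> to \<open>K\<close> is
      \<open>b \<cdot> d 1\<close>; it takes values in \<open>N\<close> and is there the cocycle
      \<open>a\<close>.\<close>
    obtain b where b: "arr C (P 1) b E" "\<pi> \<cdot> b = t \<cdot> q"
      using pr[of 1] short_exactD(4)[OF S] comp_arr[OF qa t] arr_obj(1)[OF \<pi>]
      unfolding projective_def arr_def by blast
    have "(t \<cdot> q) \<cdot> k2 = zerom C K2 M" by (rule comp_zeroR[OF qk2 k2a(1) qa t])
    then have tqd: "(t \<cdot> q) \<cdot> d 1 = zerom C (P 2) M"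
      using comp_zeroL[OF _ q2a k2a(1) comp_arr[OF qa t]] d1 by simp
    have "\<pi> \<cdot> (b \<cdot> d 1) = zerom C (P 2) M" using comp_assoc[OF k3a(2) b(1) \<pi>] b(2) tqd by simp
    then obtain a where a: "arr C (P 2) a N" "\<iota> \<cdot> a = b \<cdot> d 1"
      using kernel_factor[OF short_exactD(2)[OF S] comp_arr[OF k3a(2) b(1)]] by blast
    have "\<iota> \<cdot> (a \<cdot> d 2) = b \<cdot> (d 1 \<cdot> d 2)"
      using comp_assoc[OF d2a a(1) \<iota>] comp_assoc[OF d2a k3a(2) b(1)] a(2) by simp
    also have "\<dots> = zerom C (P 3) E" using d12 comp_zero_right[OF b(1) arr_obj(1)[OF d2a]] by simp
    finally have "a \<cdot> d 2 = zerom C (P 3) N"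
      by (rule monic_zeroD[OF short_exactD(1)[OF S] comp_arr[OF d2a a(1)]])
    then obtain c where c: "arr C (P 1) c N" "c \<cdot> d 1 = a" using ext a(1) by blast
    note \<iota>c = comp_arr[OF c(1) \<iota>]
    \<comment> \<open>Because \<open>a\<close> is the coboundary of \<open>c\<close>, the corrected
      lift \<open>b' = b - \<iota> \<cdot> c\<close> kills \<open>d 1\<close>. It still lifts
      \<open>t \<cdot> q\<close>, since \<open>\<pi> \<cdot> \<iota> = 0\<close>.\<close>
    obtain b' where b': "arr C (P 1) b' E" "addm C b' (\<iota> \<cdot> c) = b"
      using ex_difference[OF b(1) \<iota>c] .
    have "addm C (b' \<cdot> d 1) (b \<cdot> d 1) = b \<cdot> d 1"
      using comp_add_left[OF k3a(2) b'(1) \<iota>c] comp_eq_right[OF k3a(2) c(1) \<iota> c(2)] a(2) b'(2) by simp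
    then have "b' \<cdot> d 1 = zerom C (P 2) E"
      by (rule add_eq_self[OF comp_arr[OF k3a(2) b'(1)] comp_arr[OF k3a(2) b(1)]])
    then have "(b' \<cdot> k2) \<cdot> q2 = zerom C (P 2) E" using comp_assoc[OF q2a k2a(1) b'(1)] d1 by simp
    then have "b' \<cdot> k2 = zerom C K2 E" by (rule epic_zeroD[OF q2 comp_arr[OF k2a(1) b'(1)]])
    then obtain t' where t': "arr C K t' E" "t' \<cdot> q = b'" using cokernel_factor[OF qc b'(1)] by blast
    have "\<pi> \<cdot> b = \<pi> \<cdot> b'"
      using comp_add_right[OF b'(1) \<iota>c \<pi>] comp_zeroL[OF \<pi>\<iota> c(1) \<iota> \<pi>]
        add_zero[OF comp_arr[OF b'(1) \<pi>]] b'(2) by simp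
    then have "(\<pi> \<cdot> t') \<cdot> q = t \<cdot> q" using comp_eq_right[OF qa t'(1) \<pi> t'(2)] b(2) by simp
    then have "\<pi> \<cdot> t' = t" by (rule epicD[OF q comp_arr[OF t'(1) \<pi>] t])
    then show ?thesis using t'(1) by blast
  qed
  moreover have "short_exact C K k (P 0) e Q"
    by (rule short_exactI[OF km epic_cokernel_of_kernel[OF e k]])
  ultimately show thesis using that pr by blast
qed

text \<open>The extension \<open>E\<close> of \<open>X\<close> by \<open>N\<close> is to be the
  restriction of an extension \<open>D\<close> of \<open>Y\<close>. In the long exact sequence for
  \<open>T\<close>, the obstruction to extending its class from Ext^1(X, N) to Ext^1(Y, N) lies in
  Ext^2(Q, N).\<close>

lemma extend_extension:
  assumes "enough_projectives C" and tr: "trivial_group (Ext C 2 Q N)"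
    and S: "short_exact C N \<iota> E \<pi> X" and T: "short_exact C X x Y y Q"
  obtains D j r w where "short_exact C E j D r Q" "short_exact C N (j \<cdot> \<iota>) D w Y"
proof -
  note \<pi> = kernel_arr(2)[OF short_exactD(2)[OF S]]
    and x = kernel_arr(1)[OF short_exactD(2)[OF T]] and y = kernel_arr(2)[OF short_exactD(2)[OF T]]
  obtain K k P e where K: "short_exact C K k P e Q" "projective C P"
    and lift: "\<forall>t. arr C K t X \<longrightarrow> (\<exists>t'. arr C K t' E \<and> \<pi> \<cdot> t' = t)"
    using syzygy_lifting[OF assms(1) tr arr_obj(2)[OF y] S] .
  note k = kernel_arr(1)[OF short_exactD(2)[OF K(1)]] and e = kernel_arr(2)[OF short_exactD(2)[OF K(1)]]
    and ek = kernel_arr(3)[OF short_exactD(2)[OF K(1)]]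
  \<comment> \<open>\<open>s\<close> lifts \<open>e\<close> to \<open>Y\<close> and restricts to a
    map \<open>t\<close> from the syzygy \<open>K\<close> to \<open>X\<close>. Pushing
    \<open>k\<close> out along a lift \<open>t'\<close> of \<open>t\<close> to \<open>E\<close>
    gives an extension of \<open>Q\<close> by \<open>E\<close> that maps to
    \<open>Y\<close>.\<close>
  obtain s where s: "arr C P s Y" "y \<cdot> s = e"
    using K(2) short_exactD(4)[OF T] e arr_obj(1)[OF y] unfolding projective_def arr_def by blast
  have "y \<cdot> (s \<cdot> k) = zerom C K Q" using comp_assoc[OF k s(1) y] s(2) ek by simp
  then obtain t where t: "arr C K t X" "x \<cdot> t = s \<cdot> k"
    using kernel_factor[OF short_exactD(2)[OF T] comp_arr[OF k s(1)]] by blast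
  obtain t' where t': "arr C K t' E" "\<pi> \<cdot> t' = t" using lift t(1) by blast
  obtain D g j where D: "is_pushout C K k P t' E D g j"
    using ex_pushout_monic[OF short_exactD(1)[OF K(1)] t'(1)] by blast
  obtain r where r: "short_exact C E j D r Q" "r \<cdot> g = e" using pushout_short_exact[OF D K(1)] .
  note Da = is_pushoutD[OF D] and ra = kernel_arr[OF short_exactD(2)[OF r(1)]]
  have "s \<cdot> k = (x \<cdot> \<pi>) \<cdot> t'" using comp_eq_right[OF t'(1) \<pi> x t'(2)] t(2) by simp
  then obtain w where w: "arr C D w Y" "w \<cdot> g = s" "w \<cdot> j = x \<cdot> \<pi>"
    using pushout_factor[OF D s(1) comp_arr[OF \<pi> x]] by blast
  \<comment> \<open>The map \<open>w\<close> from \<open>D\<close> to \<open>Y\<close> is compatible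
    with the projections to \<open>Q\<close>.\<close>
  have yw: "y \<cdot> w = r"
  proof (rule pushout_unique[OF D comp_arr[OF w(1) y] ra(2)])
    show "(y \<cdot> w) \<cdot> g = r \<cdot> g" using comp_eq_right[OF Da(3) w(1) y w(2)] s(2) r(2) by simp
    have "(y \<cdot> w) \<cdot> j = y \<cdot> (x \<cdot> \<pi>)" by (rule comp_eq_right[OF Da(4) w(1) y w(3)])
    also have "\<dots> = zerom C E Q"
      by (rule comp_zeroL[OF kernel_arr(3)[OF short_exactD(2)[OF T]] \<pi> x y])
    finally show "(y \<cdot> w) \<cdot> j = r \<cdot> j" using ra(3) by simp
  qed
  \<comment> \<open>The cokernel of \<open>N \<rightarrow> D\<close> is the pushout \<open>R\<close> of \<open>\<pi>\<close> along \<open>j\<close>; it is compared with \<open>Y\<close>.\<close>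
  obtain R p f where R: "is_pushout C E j D \<pi> X R p f"
    using ex_pushout_monic[OF short_exactD(1)[OF r(1)] \<pi>] by blast
  obtain r' where r': "short_exact C X f R r' Q" "r' \<cdot> p = r" using pushout_short_exact[OF R r(1)] .
  note Ra = is_pushoutD[OF R] and r'a = kernel_arr[OF short_exactD(2)[OF r'(1)]]
  obtain h where h: "arr C R h Y" "h \<cdot> p = w" "h \<cdot> f = x" using pushout_factor[OF R w(1) x w(3)] .
  have "y \<cdot> h = r'"
  proof (rule pushout_unique[OF R comp_arr[OF h(1) y] r'a(2)])
    show "(y \<cdot> h) \<cdot> p = r' \<cdot> p" using comp_eq_right[OF Ra(3) h(1) y h(2)] yw r'(2) by simp
    show "(y \<cdot> h) \<cdot> f = r' \<cdot> f"
      using comp_eq_right[OF Ra(4) h(1) y h(3)] kernel_arr(3)[OF short_exactD(2)[OF T]] r'a(3) by simp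
  qed
  then have "monic C R h Y" "epic C R h Y" using short_five[OF r'(1) T h(1,3)] by auto
  then have "is_cokernel C N (j \<cdot> \<iota>) D (h \<cdot> p) Y"
    using cokernel_comp_iso[OF pushout_of_cokernel[OF is_pushout_sym[OF R] short_exactD(3)[OF S]] h(1)]
    by blast
  then have "short_exact C N (j \<cdot> \<iota>) D w Y"
    using short_exactI[OF monic_comp[OF short_exactD(1)[OF S] short_exactD(1)[OF r(1)]]] h(2) by simp
  then show thesis using that r(1) by blast
qed

text \<open>The pushout \<open>E\<close> contains \<open>D'\<close> with quotient \<open>A''\<close>
  and also \<open>A\<close> with quotient \<open>Q'\<close>. Enlarging \<open>E\<close> to
  \<open>D\<close> with quotient \<open>Q''\<close> makes D/D' into \<open>D''\<close> and D/A into
  an extension of \<open>Q''\<close> by \<open>Q'\<close>.\<close>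

lemma approximation_of_extension:
  assumes "enough_projectives C" and tr: "trivial_group (Ext C 2 Q'' D')"
    and A: "short_exact C A' a A b A''"
    and A': "short_exact C A' u' D' v' Q'" and A'': "short_exact C A'' u'' D'' v'' Q''"
  obtains D Q u v i p i' p' where "short_exact C A u D v Q"
    "short_exact C D' i D p D''" "short_exact C Q' i' Q p' Q''"
proof -
  note u' = monic_arr[OF short_exactD(1)[OF A']]
  obtain E g f where E: "is_pushout C A' a A u' D' E g f"
    using ex_pushout_monic[OF short_exactD(1)[OF A] u'] by blast
  obtain \<pi> where \<pi>: "short_exact C D' f E \<pi> A''" using pushout_short_exact[OF E A] .
  obtain q where q: "short_exact C A g E q Q'" using pushout_short_exact[OF is_pushout_sym[OF E] A'] .
  obtain D j r w where j: "short_exact C E j D r Q''" and D: "short_exact C D' (j \<cdot> f) D w D''"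
    using extend_extension[OF assms(1) tr \<pi> A''] .
  \<comment> \<open>\<open>Q\<close> is D/A, built as the pushout of \<open>E\<close> to
    \<open>D\<close> along \<open>E\<close> to \<open>Q'\<close>. One reading of this square gives
    the sequence for \<open>Q\<close>, the other the cokernel of \<open>A\<close> in
    \<open>D\<close>.\<close>
  obtain Q v i' where Q: "is_pushout C E j D q Q' Q v i'"
    using ex_pushout_monic[OF short_exactD(1)[OF j] epic_arr[OF short_exactD(4)[OF q]]] by blast
  obtain p' where p': "short_exact C Q' i' Q p' Q''" using pushout_short_exact[OF Q j] .
  have "short_exact C A (j \<cdot> g) D v Q"
    using short_exactI[OF monic_comp[OF short_exactD(1)[OF q] short_exactD(1)[OF j]]
        pushout_of_cokernel[OF is_pushout_sym[OF Q] short_exactD(3)[OF q]]] .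
  then show thesis using that D p' by blast
qed

section \<open>Induction along finite filtrations and closure of \<open>App\<close> under
  extensions\<close>

lemma short_exact_zero:
  assumes Z: "zero_object C Z"
  shows "short_exact C Z (idm C Z) Z (idm C Z) Z"
proof -
  have obZ: "Z \<in> obj C" using Z by (simp add: zero_object_def)
  note i = id_arr[OF obZ]
  have "is_cokernel C Z (idm C Z) Z (idm C Z) Z"
  proof (rule is_cokernelI[OF i _ epic_id[OF obZ]])
    show "idm C Z \<cdot> idm C Z = zerom C Z Z" by (rule zero_objectD(1)[OF Z comp_arr[OF i i]])
    fix W g assume "arr C Z g W"
    then show "\<exists>h. arr C Z h W \<and> h \<cdot> idm C Z = g" using comp_id_right by blast
  qed
  then show ?thesis by (rule short_exactI[OF monic_id[OF obZ]])
qed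

lemma zero_object_in_class:
  assumes S: "additive_class C S" and Z: "zero_object C Z"
  shows "Z \<in> S"
proof -
  obtain Z' where Z': "Z' \<in> S" "zero_object C Z'" using S unfolding additive_class_def by blast
  have "\<forall>X\<in>S. \<forall>Y. isomorphic C X Y \<longrightarrow> Y \<in> S" using S unfolding additive_class_def by blast
  then show ?thesis using Z'(1) zero_object_isomorphic[OF Z'(2) Z] by blast
qed

text \<open>Filtrations decrease with the index, so a new largest term goes in front:
  \<open>case_nat\<close> puts \<open>Y'\<close> at index 0 and shifts the old terms up by one,
  leaving \<open>G 0\<close> as the top factor.\<close>

lemma filtration_Suc:
  assumes X: "filtration C m Y X k (\<lambda>r. G (Suc r))" and Y: "short_exact C Y i Y' p (G 0)"
  shows "filtration C (Suc m) Y' (case_nat Y' X) (case_nat i k) G"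
proof -
  have "isomorphic C (G 0) (G 0)"
    using isomorphic_refl arr_obj(2)[OF epic_arr[OF short_exactD(4)[OF Y]]] by simp
  then have "monic C (X 0) i Y' \<and> (\<exists>p N. is_cokernel C (X 0) i Y' p N \<and> isomorphic C N (G 0))"
    using short_exactD(1,3)[OF Y] X unfolding filtration_def by blast
  then show ?thesis using X unfolding filtration_def by (auto simp: less_Suc_eq_0_disj)
qed

text \<open>Works for any finite chain \<open>A r\<close> ending in zero. The claim also carries
  membership of the new objects in \<open>\<D>\<close> and \<open>\<Q>\<close>, since
  \<open>D\<^sub>A \<in> \<D>\<close> is what makes the Ext^2 hypothesis available at the next
  induction step.\<close>

lemma ex_approximation_filtration:
  assumes "enough_projectives C" "additive_class C \<D>" "additive_class C \<Q>"
    and "extension_closed C \<D>" "extension_closed C \<Q>" and ext: "Ext_vanishes C 2 \<Q> \<D>"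
    and "zero_object C (A m)"
    and "\<And>r. r < m \<Longrightarrow> short_exact C (A (Suc r)) (i r) (A r) (p r) (G r)"
    and "\<And>r. r < m \<Longrightarrow> short_exact C (G r) (u r) (D\<^sub>0 r) (v r) (Q\<^sub>0 r)"
    and "\<And>r. r < m \<Longrightarrow> D\<^sub>0 r \<in> \<D> \<and> Q\<^sub>0 r \<in> \<Q>"
  shows "\<exists>D\<^sub>A Q\<^sub>A a b D d Q q. D\<^sub>A \<in> \<D> \<and> Q\<^sub>A \<in> \<Q> \<and> short_exact C (A 0) a D\<^sub>A b Q\<^sub>A \<and>
    filtration C m D\<^sub>A D d D\<^sub>0 \<and> filtration C m Q\<^sub>A Q q Q\<^sub>0"
  using assms(7-)
proof (induction m arbitrary: A i p G u v D\<^sub>0 Q\<^sub>0)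
  case 0
  have "A 0 \<in> \<D>" "A 0 \<in> \<Q>"
    using assms(2,3) zero_object_in_class[OF _ 0(1)] by auto
  moreover have "filtration C 0 (A 0) (\<lambda>_. A 0) k H" for k H
    using 0(1) unfolding filtration_def by simp
  ultimately show ?case using short_exact_zero[OF 0(1)] by blast
next
  case (Suc m)
  have "\<exists>D\<^sub>A Q\<^sub>A a b D d Q q. D\<^sub>A \<in> \<D> \<and> Q\<^sub>A \<in> \<Q> \<and> short_exact C (A (Suc 0)) a D\<^sub>A b Q\<^sub>A \<and>
    filtration C m D\<^sub>A D d (\<lambda>r. D\<^sub>0 (Suc r)) \<and> filtration C m Q\<^sub>A Q q (\<lambda>r. Q\<^sub>0 (Suc r))"
    \<comment> \<open>The induction hypothesis is applied to the chain starting at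
      \<open>A 1\<close>; the top factor \<open>G 0\<close> is added afterwards by the
      horseshoe.\<close>
    by (rule Suc.IH[of "\<lambda>r. A (Suc r)" "\<lambda>r. i (Suc r)" "\<lambda>r. p (Suc r)" "\<lambda>r. G (Suc r)"
          "\<lambda>r. u (Suc r)" "\<lambda>r. D\<^sub>0 (Suc r)" "\<lambda>r. v (Suc r)" "\<lambda>r. Q\<^sub>0 (Suc r)"])
      (use Suc.prems in simp_all)
  then obtain D' Q' a b D d Q q where D': "D' \<in> \<D>" "Q' \<in> \<Q>" "short_exact C (A (Suc 0)) a D' b Q'"
    and filt: "filtration C m D' D d (\<lambda>r. D\<^sub>0 (Suc r))" "filtration C m Q' Q q (\<lambda>r. Q\<^sub>0 (Suc r))"
    by blast
  have 0: "D\<^sub>0 0 \<in> \<D>" "Q\<^sub>0 0 \<in> \<Q>" using Suc.prems(4)[of 0] by auto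
  have tr: "trivial_group (Ext C 2 (Q\<^sub>0 0) D')" using ext 0(2) D'(1) unfolding Ext_vanishes_def by blast
  obtain D'' Q'' u' v' i\<^sub>1 p\<^sub>1 i\<^sub>2 p\<^sub>2 where new: "short_exact C (A 0) u' D'' v' Q''"
    "short_exact C D' i\<^sub>1 D'' p\<^sub>1 (D\<^sub>0 0)" "short_exact C Q' i\<^sub>2 Q'' p\<^sub>2 (Q\<^sub>0 0)"
    using approximation_of_extension[OF assms(1) tr Suc.prems(2)[OF zero_less_Suc] D'(3)
        Suc.prems(3)[OF zero_less_Suc]] .
  have "D'' \<in> \<D>" "Q'' \<in> \<Q>"
    using assms(4,5) new(2,3) D'(1,2) 0 unfolding extension_closed_def by blast+
  then show ?case using new(1) filtration_Suc[OF filt(1) new(2)] filtration_Suc[OF filt(2) new(3)] by blast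
qed

lemma extension_closed_App:
  assumes "enough_projectives C" "extension_closed C \<D>" "extension_closed C \<Q>"
    and ext: "Ext_vanishes C 2 \<Q> \<D>"
  shows "extension_closed C (App C \<D> \<Q>)"
  unfolding extension_closed_def
proof (intro allI impI, elim conjE)
  fix X Y Z f g assume S: "short_exact C X f Y g Z" and "X \<in> App C \<D> \<Q>" "Z \<in> App C \<D> \<Q>"
  then obtain D' Q' u' v' D'' Q'' u'' v'' where D: "D' \<in> \<D>" "Q' \<in> \<Q>" "D'' \<in> \<D>" "Q'' \<in> \<Q>"
    and *: "short_exact C X u' D' v' Q'" "short_exact C Z u'' D'' v'' Q''"
    unfolding App_def by blast
  have tr: "trivial_group (Ext C 2 Q'' D')" using ext D unfolding Ext_vanishes_def by blast
  obtain D Q u v i p i' p' where new: "short_exact C Y u D v Q" "short_exact C D' i D p D''"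
    "short_exact C Q' i' Q p' Q''"
    using approximation_of_extension[OF assms(1) tr S *] .
  have "D \<in> \<D>" "Q \<in> \<Q>" using assms(2,3) new(2,3) D unfolding extension_closed_def by blast+
  then show "Y \<in> App C \<D> \<Q>"
    using new(1) arr_obj(1)[OF monic_arr[OF short_exactD(1)[OF new(1)]]] unfolding App_def by blast
qed

end

section \<open>The \<open>\<eta>\<close>-extension as an abelian category\<close>

locale eta_extension_data = abelian_category B + additive_endofunctor B F
  for B :: "('o, 'm) cat" (structure) and F :: "('o, 'm) endofun" +
  fixes \<eta> :: "'o \<Rightarrow> 'm"
  assumes right_exact_F: "right_exact B F" and nat_trans_eta: "nat_trans_sq B F \<eta>"
begin

abbreviation \<A> where "\<A> \<equiv> eta_extension B F \<eta>"

section \<open>The functor \<open>F\<close> and its right exactness\<close>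

lemma F_arr: "arr B X f Y \<Longrightarrow> arr B (fob F X) (fmor F f) (fob F Y)"
  using fob_closed fmor_closed by (auto simp: arr_def)

lemma F_comp: "\<lbrakk>arr B X f Y; arr B Y g Z\<rbrakk> \<Longrightarrow> fmor F (g \<cdot> f) = fmor F g \<cdot> fmor F f"
  using fmor_cmp by (auto simp: arr_def)

lemma F_add: "\<lbrakk>arr B X f Y; arr B X g Y\<rbrakk> \<Longrightarrow> fmor F (addm B f g) = addm B (fmor F f) (fmor F g)"
  using fmor_add by (auto simp: arr_def)

lemma F_zero:
  assumes "X \<in> obj B" "Y \<in> obj B"
  shows "fmor F (zerom B X Y) = zerom B (fob F X) (fob F Y)"
proof -
  note z = zero_arr[OF assms]
  have "addm B (fmor F (zerom B X Y)) (fmor F (zerom B X Y)) = fmor F (zerom B X Y)"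
    unfolding F_add[OF z z, symmetric] add_zero[OF z] ..
  then show ?thesis by (rule add_eq_self[OF F_arr[OF z] F_arr[OF z]])
qed

lemma eta_arr: "X \<in> obj B \<Longrightarrow> arr B (fob F (fob F X)) (\<eta> X) (fob F X)"
  using nat_trans_eta fob_closed unfolding nat_trans_sq_def arr_def by blast

lemma eta_natural: "arr B X f Y \<Longrightarrow> fmor F f \<cdot> \<eta> X = \<eta> Y \<cdot> fmor F (fmor F f)"
  using nat_trans_eta unfolding nat_trans_sq_def arr_def by blast

lemma F_epic:
  assumes p: "epic B X p Y"
  shows "epic B (fob F X) (fmor F p) (fob F Y)"
proof -
  obtain K k where k: "is_kernel B K k X p Y" using kernelE[OF epic_arr[OF p]] .
  have "short_exact B K k X p Y"
    by (rule short_exactI[OF kernel_monic[OF k] epic_cokernel_of_kernel[OF p k]])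
  then show ?thesis using right_exact_F unfolding right_exact_def by blast
qed

text \<open>Right exactness is given for short exact sequences only, so \<open>f\<close> is factored
  through its image \<open>J\<close>. As \<open>fmor F q\<close> is epic, a map killing
  \<open>fmor F f\<close> already kills \<open>fmor F i\<close>, and the sequence starting at
  \<open>J\<close> applies.\<close>

lemma F_cokernel:
  assumes p: "is_cokernel B X f Y p N"
  shows "is_cokernel B (fob F X) (fmor F f) (fob F Y) (fmor F p) (fob F N)"
proof -
  note pa = cokernel_arr[OF p]
  obtain J q i where "image_factorization B X f Y J q i" using ex_image_factorization[OF pa(1)] by blast
  then have q: "epic B X q J" and i: "monic B J i Y" and f: "f = i \<cdot> q"
    unfolding image_factorization_def by auto
  note qa = epic_arr[OF q] and ia = monic_arr[OF i]
  have "is_cokernel B J i Y p N" using cokernel_of_image[OF _ q ia] p f by simp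
  then have "short_exact B J i Y p N" by (rule short_exactI[OF i])
  then have "exact_at B (fob F J) (fmor F i) (fob F Y) (fmor F p) (fob F N)"
    using right_exact_F unfolding right_exact_def by blast
  then obtain J' q' i' where q': "epic B (fob F J) q' J'" and i': "monic B J' i' (fob F Y)"
    and Fi: "fmor F i = i' \<cdot> q'" and k: "is_kernel B J' i' (fob F Y) (fmor F p) (fob F N)"
    using exact_atE by metis
  note c = epic_cokernel_of_kernel[OF F_epic[OF cokernel_epic[OF p]] k]
  have Ff: "fmor F f = fmor F i \<cdot> fmor F q" using F_comp[OF qa ia] f by simp
  show ?thesis
  proof (rule is_cokernelI[OF F_arr[OF pa(1)] _ F_epic[OF cokernel_epic[OF p]]])
    show "fmor F p \<cdot> fmor F f = zerom B (fob F X) (fob F N)"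
      using F_comp[OF pa(1,2)] F_zero[OF arr_obj(1)[OF pa(1)] arr_obj(2)[OF pa(2)]] pa(3) by simp
    fix W g assume g: "arr B (fob F Y) g W" "g \<cdot> fmor F f = zerom B (fob F X) W"
    have "(g \<cdot> fmor F i) \<cdot> fmor F q = zerom B (fob F X) W"
      using comp_assoc[OF F_arr[OF qa] F_arr[OF ia] g(1)] Ff g(2) by simp
    then have "g \<cdot> fmor F i = zerom B (fob F J) W"
      by (rule epic_zeroD[OF F_epic[OF q] comp_arr[OF F_arr[OF ia] g(1)]])
    then have "(g \<cdot> i') \<cdot> q' = zerom B (fob F J) W"
      using comp_assoc[OF epic_arr[OF q'] monic_arr[OF i'] g(1)] Fi by simp
    then have "g \<cdot> i' = zerom B J' W"
      by (rule epic_zeroD[OF q' comp_arr[OF monic_arr[OF i'] g(1)]])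
    then show "\<exists>h. arr B (fob F N) h W \<and> h \<cdot> fmor F p = g" using cokernel_factor[OF c g(1)] by blast
  qed
qed

section \<open>Morphisms and hom-groups of the \<eta>-extension\<close>

lemma cmp_\<A> [simp]: "cmp \<A> = cmp B"
  and addm_\<A> [simp]: "addm \<A> = addm B"
  and idm_\<A> [simp]: "idm \<A> X = idm B (fst X)"
  and zerom_\<A> [simp]: "zerom \<A> X Y = zerom B (fst X) (fst Y)"
  by (auto simp: eta_extension_def split: prod.splits)

lemma obj_\<A>: "(X, f) \<in> obj \<A> \<longleftrightarrow> arr B (fob F X) f X \<and> f \<cdot> fmor F f = f \<cdot> \<eta> X"
  using fob_closed by (auto simp: eta_extension_def arr_def)

lemma mor_\<A>: "mor \<A> (X, f) (Y, g) = {\<alpha> \<in> mor B X Y. \<alpha> \<cdot> f = g \<cdot> fmor F \<alpha>}"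
  by (simp add: eta_extension_def)

lemma obj_\<A>_arr: "X \<in> obj \<A> \<Longrightarrow> arr B (fob F (fst X)) (snd X) (fst X)"
  using obj_\<A>[of "fst X" "snd X"] by simp

lemma obj_\<A>_fst: "X \<in> obj \<A> \<Longrightarrow> fst X \<in> obj B"
  using arr_obj(2)[OF obj_\<A>_arr] .

lemma arr_\<A>_iff:
  "arr \<A> X \<alpha> Y \<longleftrightarrow> X \<in> obj \<A> \<and> Y \<in> obj \<A> \<and> arr B (fst X) \<alpha> (fst Y) \<and>
     \<alpha> \<cdot> snd X = snd Y \<cdot> fmor F \<alpha>"
  using obj_\<A>_fst[of X] obj_\<A>_fst[of Y] mor_\<A>[of "fst X" "snd X" "fst Y" "snd Y"] by (auto simp: arr_def)

lemma arr_\<A>D: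
  assumes "arr \<A> X \<alpha> Y"
  shows "X \<in> obj \<A>" "Y \<in> obj \<A>" "arr B (fst X) \<alpha> (fst Y)" "\<alpha> \<cdot> snd X = snd Y \<cdot> fmor F \<alpha>"
  using assms unfolding arr_\<A>_iff by auto

lemma comp_arr_\<A>:
  assumes a: "arr \<A> X \<alpha> Y" and b: "arr \<A> Y \<beta> Z"
  shows "arr \<A> X (\<beta> \<cdot> \<alpha>) Z"
proof -
  note a' = arr_\<A>D[OF a] and b' = arr_\<A>D[OF b]
  note f = obj_\<A>_arr[OF a'(1)] and g = obj_\<A>_arr[OF a'(2)] and h = obj_\<A>_arr[OF b'(2)]
  have "(\<beta> \<cdot> \<alpha>) \<cdot> snd X = \<beta> \<cdot> (snd Y \<cdot> fmor F \<alpha>)" by (rule comp_eq_right[OF f a'(3) b'(3) a'(4)])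
  also have "\<dots> = (snd Z \<cdot> fmor F \<beta>) \<cdot> fmor F \<alpha>"
    by (rule comp_eq_left[OF F_arr[OF a'(3)] g b'(3,4)])
  also have "\<dots> = snd Z \<cdot> fmor F (\<beta> \<cdot> \<alpha>)"
    using comp_assoc[OF F_arr[OF a'(3)] F_arr[OF b'(3)] h] F_comp[OF a'(3) b'(3)] by simp
  finally show ?thesis using a'(1) b'(2) comp_arr[OF a'(3) b'(3)] unfolding arr_\<A>_iff by simp
qed

lemma id_arr_\<A>:
  assumes X: "X \<in> obj \<A>"
  shows "arr \<A> X (idm B (fst X)) X"
proof -
  note f = obj_\<A>_arr[OF X]
  have "fst X \<in> obj B" by (rule arr_obj[OF f])
  then show ?thesis
    using X id_arr comp_id_left[OF f] comp_id_right[OF f] fmor_id unfolding arr_\<A>_iff by simp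
qed

lemma zero_arr_\<A>:
  assumes X: "X \<in> obj \<A>" and Y: "Y \<in> obj \<A>"
  shows "arr \<A> X (zerom B (fst X) (fst Y)) Y"
proof -
  note f = obj_\<A>_arr[OF X] and g = obj_\<A>_arr[OF Y]
  have obs: "fst X \<in> obj B" "fst Y \<in> obj B" "fob F (fst X) \<in> obj B" using arr_obj[OF f] arr_obj[OF g] by simp_all
  show ?thesis
    using X Y zero_arr[OF obs(1,2)] comp_zero_left[OF f obs(2)] comp_zero_right[OF g obs(3)]
      F_zero[OF obs(1,2)] unfolding arr_\<A>_iff by simp
qed

lemma add_arr_\<A>:
  assumes a: "arr \<A> X \<alpha> Y" and b: "arr \<A> X \<beta> Y"
  shows "arr \<A> X (addm B \<alpha> \<beta>) Y"
proof -
  note a' = arr_\<A>D[OF a] and b' = arr_\<A>D[OF b]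
  note f = obj_\<A>_arr[OF a'(1)] and g = obj_\<A>_arr[OF a'(2)]
  have "addm B \<alpha> \<beta> \<cdot> snd X = snd Y \<cdot> fmor F (addm B \<alpha> \<beta>)"
    using comp_add_left[OF f a'(3) b'(3)] comp_add_right[OF F_arr[OF a'(3)] F_arr[OF b'(3)] g]
      F_add[OF a'(3) b'(3)] a'(4) b'(4) by simp
  then show ?thesis using a'(1,2) add_arr[OF a'(3) b'(3)] unfolding arr_\<A>_iff by simp
qed

text \<open>The negative exists in \<open>B\<close>. That it respects the structure maps follows
  from the same fact for \<alpha> and for the zero sum, by additivity of \<open>F\<close> and
  cancellation.\<close>

lemma ex_neg_\<A>:
  assumes a: "arr \<A> X \<alpha> Y"
  shows "\<exists>\<delta>. arr \<A> X \<delta> Y \<and> addm B \<delta> \<alpha> = zerom B (fst X) (fst Y)"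
proof -
  note a' = arr_\<A>D[OF a]
  note f = obj_\<A>_arr[OF a'(1)] and g = obj_\<A>_arr[OF a'(2)]
  note z = arr_\<A>D[OF zero_arr_\<A>[OF a'(1,2)]]
  obtain \<delta> where d: "arr B (fst X) \<delta> (fst Y)" "addm B \<delta> \<alpha> = zerom B (fst X) (fst Y)"
    using ex_difference[OF z(3) a'(3)] .
  have "addm B (\<delta> \<cdot> snd X) (\<alpha> \<cdot> snd X) = zerom B (fst X) (fst Y) \<cdot> snd X"
    using comp_add_left[OF f d(1) a'(3)] d(2) by simp
  also have "\<dots> = addm B (snd Y \<cdot> fmor F \<delta>) (\<alpha> \<cdot> snd X)"
    using comp_add_right[OF F_arr[OF d(1)] F_arr[OF a'(3)] g] F_add[OF d(1) a'(3)] d(2) z(4) a'(4)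
    by simp
  finally have "\<delta> \<cdot> snd X = snd Y \<cdot> fmor F \<delta>"
    by (rule add_right_cancel[OF comp_arr[OF f d(1)] comp_arr[OF F_arr[OF d(1)] g] comp_arr[OF f a'(3)]])
  then show ?thesis using d a'(1,2) unfolding arr_\<A>_iff by blast
qed

lemma comm_group_hom_\<A>:
  assumes X: "X \<in> obj \<A>" and Y: "Y \<in> obj \<A>"
  shows "comm_group (hom_group \<A> X Y)"
proof -
  have mor: "\<alpha> \<in> mor \<A> X Y \<longleftrightarrow> arr \<A> X \<alpha> Y" for \<alpha> using X Y by (simp add: arr_def)
  have obs: "fst X \<in> obj B" "fst Y \<in> obj B" using obj_\<A>_fst X Y by simp_all
  interpret h: comm_group "hom_group B (fst X) (fst Y)" by (rule hom_comm_group[OF obs])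
  have car: "\<alpha> \<in> carrier (hom_group B (fst X) (fst Y))" if "arr \<A> X \<alpha> Y" for \<alpha>
    using arr_\<A>D(3)[OF that] by (simp add: arr_def hom_group_def)
  show ?thesis
  proof (rule comm_groupI)
    fix \<alpha> \<beta> \<gamma> assume "\<alpha> \<in> carrier (hom_group \<A> X Y)" "\<beta> \<in> carrier (hom_group \<A> X Y)"
      "\<gamma> \<in> carrier (hom_group \<A> X Y)"
    then have *: "arr \<A> X \<alpha> Y" "arr \<A> X \<beta> Y" "arr \<A> X \<gamma> Y" by (simp_all add: hom_group_def mor)
    show "\<alpha> \<otimes>\<^bsub>hom_group \<A> X Y\<^esub> \<beta> \<otimes>\<^bsub>hom_group \<A> X Y\<^esub> \<gamma> =
      \<alpha> \<otimes>\<^bsub>hom_group \<A> X Y\<^esub> (\<beta> \<otimes>\<^bsub>hom_group \<A> X Y\<^esub> \<gamma>)"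
      using h.m_assoc[OF *[THEN car]] by (simp add: hom_group_def)
  next
    fix \<alpha> \<beta> assume "\<alpha> \<in> carrier (hom_group \<A> X Y)" "\<beta> \<in> carrier (hom_group \<A> X Y)"
    then have *: "arr \<A> X \<alpha> Y" "arr \<A> X \<beta> Y" by (simp_all add: hom_group_def mor)
    show "\<alpha> \<otimes>\<^bsub>hom_group \<A> X Y\<^esub> \<beta> \<in> carrier (hom_group \<A> X Y)"
      using add_arr_\<A>[OF *] by (simp add: hom_group_def mor)
    show "\<alpha> \<otimes>\<^bsub>hom_group \<A> X Y\<^esub> \<beta> = \<beta> \<otimes>\<^bsub>hom_group \<A> X Y\<^esub> \<alpha>"
      using h.m_comm[OF *[THEN car]] by (simp add: hom_group_def)
  next
    fix \<alpha> assume "\<alpha> \<in> carrier (hom_group \<A> X Y)"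
    then have *: "arr \<A> X \<alpha> Y" by (simp add: hom_group_def mor)
    show "\<one>\<^bsub>hom_group \<A> X Y\<^esub> \<otimes>\<^bsub>hom_group \<A> X Y\<^esub> \<alpha> = \<alpha>"
      using add_zero(2)[OF arr_\<A>D(3)[OF *]] by (simp add: hom_group_def)
    show "\<exists>\<delta>\<in>carrier (hom_group \<A> X Y). \<delta> \<otimes>\<^bsub>hom_group \<A> X Y\<^esub> \<alpha> = \<one>\<^bsub>hom_group \<A> X Y\<^esub>"
      using ex_neg_\<A>[OF *] by (auto simp: hom_group_def mor)
  qed (use zero_arr_\<A>[OF X Y] in \<open>simp add: hom_group_def mor\<close>)
qed

lemma mor_\<A>D:
  "\<lbrakk>X \<in> obj \<A>; Y \<in> obj \<A>; \<alpha> \<in> mor \<A> X Y\<rbrakk> \<Longrightarrow> arr B (fst X) \<alpha> (fst Y)"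
  using arr_\<A>D(3) by (simp add: arr_def)

lemma mor_\<A>_arr: "\<lbrakk>X \<in> obj \<A>; Y \<in> obj \<A>\<rbrakk> \<Longrightarrow> \<alpha> \<in> mor \<A> X Y \<longleftrightarrow> arr \<A> X \<alpha> Y"
  by (simp add: arr_def)

lemma preadditive_\<A>: "preadditive_category \<A>"
proof (intro preadditive_category.intro category.intro preadditive_category_axioms.intro)
  fix X Y Z \<alpha> \<beta> assume "X \<in> obj \<A>" "Y \<in> obj \<A>" "Z \<in> obj \<A>" "\<alpha> \<in> mor \<A> X Y" "\<beta> \<in> mor \<A> Y Z"
  then show "cmp \<A> \<beta> \<alpha> \<in> mor \<A> X Z" using comp_arr_\<A> by (simp add: mor_\<A>_arr)
next
  fix X assume "X \<in> obj \<A>"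
  then show "idm \<A> X \<in> mor \<A> X X" using id_arr_\<A> by (simp add: mor_\<A>_arr)
next
  fix W X Y Z \<alpha> \<beta> \<gamma> assume "W \<in> obj \<A>" "X \<in> obj \<A>" "Y \<in> obj \<A>" "Z \<in> obj \<A>"
    "\<alpha> \<in> mor \<A> W X" "\<beta> \<in> mor \<A> X Y" "\<gamma> \<in> mor \<A> Y Z"
  then have *: "arr B (fst W) \<alpha> (fst X)" "arr B (fst X) \<beta> (fst Y)" "arr B (fst Y) \<gamma> (fst Z)"
    by (simp_all add: mor_\<A>D)
  show "cmp \<A> \<gamma> (cmp \<A> \<beta> \<alpha>) = cmp \<A> (cmp \<A> \<gamma> \<beta>) \<alpha>" using comp_assoc[OF *] by simp
next
  fix X Y \<alpha> assume "X \<in> obj \<A>" "Y \<in> obj \<A>" "\<alpha> \<in> mor \<A> X Y"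
  then have *: "arr B (fst X) \<alpha> (fst Y)" by (simp_all add: mor_\<A>D)
  show "cmp \<A> \<alpha> (idm \<A> X) = \<alpha>" using comp_id_right[OF *] by simp
  show "cmp \<A> (idm \<A> Y) \<alpha> = \<alpha>" using comp_id_left[OF *] by simp
next
  fix X Y assume "X \<in> obj \<A>" "Y \<in> obj \<A>"
  then show "comm_group (hom_group \<A> X Y)" by (rule comm_group_hom_\<A>)
next
  fix X Y Z \<alpha> \<beta> \<gamma> assume "X \<in> obj \<A>" "Y \<in> obj \<A>" "Z \<in> obj \<A>"
    "\<alpha> \<in> mor \<A> X Y" "\<beta> \<in> mor \<A> X Y" "\<gamma> \<in> mor \<A> Y Z"
  then have *: "arr B (fst X) \<alpha> (fst Y)" "arr B (fst X) \<beta> (fst Y)" "arr B (fst Y) \<gamma> (fst Z)"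
    by (simp_all add: mor_\<A>D)
  show "cmp \<A> \<gamma> (addm \<A> \<alpha> \<beta>) = addm \<A> (cmp \<A> \<gamma> \<alpha>) (cmp \<A> \<gamma> \<beta>)"
    using comp_add_right[OF *] by simp
next
  fix X Y Z \<alpha> \<beta> \<gamma> assume "X \<in> obj \<A>" "Y \<in> obj \<A>" "Z \<in> obj \<A>"
    "\<alpha> \<in> mor \<A> X Y" "\<beta> \<in> mor \<A> Y Z" "\<gamma> \<in> mor \<A> Y Z"
  then have *: "arr B (fst X) \<alpha> (fst Y)" "arr B (fst Y) \<beta> (fst Z)" "arr B (fst Y) \<gamma> (fst Z)"
    by (simp_all add: mor_\<A>D)
  show "cmp \<A> (addm \<A> \<beta> \<gamma>) \<alpha> = addm \<A> (cmp \<A> \<beta> \<alpha>) (cmp \<A> \<gamma> \<alpha>)"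
    using comp_add_left[OF *] by simp
qed

section \<open>Kernels and cokernels of the \<eta>-extension computed in the base category\<close>

lemma monic_\<A>I:
  assumes a: "arr \<A> X \<alpha> Y" and m: "monic B (fst X) \<alpha> (fst Y)"
  shows "monic \<A> X \<alpha> Y"
proof -
  interpret A: preadditive_category \<A> by (rule preadditive_\<A>)
  show ?thesis
  proof (rule A.monicI[OF a])
    fix W g h assume g: "arr \<A> W g X" and h: "arr \<A> W h X" and "cmp \<A> \<alpha> g = cmp \<A> \<alpha> h"
    then show "g = h" using monicD[OF m arr_\<A>D(3)[OF g] arr_\<A>D(3)[OF h]] by simp
  qed
qed

lemma epic_\<A>I:
  assumes a: "arr \<A> X \<alpha> Y" and m: "epic B (fst X) \<alpha> (fst Y)"
  shows "epic \<A> X \<alpha> Y"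
proof -
  interpret A: preadditive_category \<A> by (rule preadditive_\<A>)
  show ?thesis
  proof (rule A.epicI[OF a])
    fix W g h assume g: "arr \<A> Y g W" and h: "arr \<A> Y h W" and "cmp \<A> g \<alpha> = cmp \<A> h \<alpha>"
    then show "g = h" using epicD[OF m arr_\<A>D(3)[OF g] arr_\<A>D(3)[OF h]] by simp
  qed
qed

text \<open>A factorization \<open>h\<close> found in \<open>B\<close> respects the structure maps
  automatically: the required identity holds after composing with the monic
  \<open>k\<close>.\<close>

lemma is_kernel_\<A>I:
  assumes k: "arr \<A> K k X" and a: "arr \<A> X \<alpha> Y"
    and K: "is_kernel B (fst K) k (fst X) \<alpha> (fst Y)"
  shows "is_kernel \<A> K k X \<alpha> Y"
proof -
  interpret A: preadditive_category \<A> by (rule preadditive_\<A>)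
  note k' = arr_\<A>D[OF k] and a' = arr_\<A>D[OF a]
  note m = kernel_monic[OF K]
  show ?thesis
  proof (rule A.is_kernelI[OF a])
    show "cmp \<A> \<alpha> k = zerom \<A> K Y" using kernel_arr(3)[OF K] by simp
    show "monic \<A> K k X" by (rule monic_\<A>I[OF k m])
    fix W g assume g: "arr \<A> W g X" "cmp \<A> \<alpha> g = zerom \<A> W Y"
    note g' = arr_\<A>D[OF g(1)]
    obtain h where h: "arr B (fst W) h (fst K)" "k \<cdot> h = g"
      using kernel_factor[OF K g'(3)] g(2) by auto
    note fW = obj_\<A>_arr[OF g'(1)] and fK = obj_\<A>_arr[OF k'(1)] and fX = obj_\<A>_arr[OF k'(2)]
    have "k \<cdot> (h \<cdot> snd W) = snd X \<cdot> fmor F (k \<cdot> h)"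
      using comp_assoc[OF fW h(1) k'(3)] h(2) g'(4) by simp
    also have "\<dots> = (snd X \<cdot> fmor F k) \<cdot> fmor F h"
      using F_comp[OF h(1) k'(3)] comp_assoc[OF F_arr[OF h(1)] F_arr[OF k'(3)] fX] by simp
    also have "\<dots> = k \<cdot> (snd K \<cdot> fmor F h)"
      using comp_assoc[OF F_arr[OF h(1)] fK k'(3)] k'(4) by simp
    finally have "h \<cdot> snd W = snd K \<cdot> fmor F h"
      by (rule monicD[OF m comp_arr[OF fW h(1)] comp_arr[OF F_arr[OF h(1)] fK]])
    then have "arr \<A> W h K" using g'(1) k'(1) h(1) unfolding arr_\<A>_iff by simp
    then show "\<exists>h. arr \<A> W h K \<and> cmp \<A> k h = g" using h(2) by auto
  qed
qed

text \<open>Dual to kernels, except that the identity for \<open>h\<close> is checked after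
  precomposing with \<open>fmor F p\<close>. This is epic by right exactness of
  \<open>F\<close>.\<close>

lemma is_cokernel_\<A>I:
  assumes a: "arr \<A> X \<alpha> Y" and p: "arr \<A> Y p N"
    and N: "is_cokernel B (fst X) \<alpha> (fst Y) p (fst N)"
  shows "is_cokernel \<A> X \<alpha> Y p N"
proof -
  interpret A: preadditive_category \<A> by (rule preadditive_\<A>)
  note p' = arr_\<A>D[OF p] and a' = arr_\<A>D[OF a]
  note e = cokernel_epic[OF N]
  show ?thesis
  proof (rule A.is_cokernelI[OF a])
    show "cmp \<A> p \<alpha> = zerom \<A> X N" using cokernel_arr(3)[OF N] by simp
    show "epic \<A> Y p N" by (rule epic_\<A>I[OF p e])
    fix W g assume g: "arr \<A> Y g W" "cmp \<A> g \<alpha> = zerom \<A> X W"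
    note g' = arr_\<A>D[OF g(1)]
    obtain h where h: "arr B (fst N) h (fst W)" "h \<cdot> p = g"
      using cokernel_factor[OF N g'(3)] g(2) by auto
    note fW = obj_\<A>_arr[OF g'(2)] and fN = obj_\<A>_arr[OF p'(2)] and fY = obj_\<A>_arr[OF p'(1)]
    have "(h \<cdot> snd N) \<cdot> fmor F p = h \<cdot> (p \<cdot> snd Y)"
      using comp_assoc[OF F_arr[OF p'(3)] fN h(1)] p'(4) by simp
    also have "\<dots> = snd W \<cdot> fmor F (h \<cdot> p)"
      using comp_assoc[OF fY p'(3) h(1)] h(2) g'(4) by simp
    also have "\<dots> = (snd W \<cdot> fmor F h) \<cdot> fmor F p"
      using F_comp[OF p'(3) h(1)] comp_assoc[OF F_arr[OF p'(3)] F_arr[OF h(1)] fW] by simp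
    finally have "h \<cdot> snd N = snd W \<cdot> fmor F h"
      by (rule epicD[OF F_epic[OF e] comp_arr[OF fN h(1)] comp_arr[OF F_arr[OF h(1)] fW]])
    then have "arr \<A> N h W" using g'(2) p'(2) h(1) unfolding arr_\<A>_iff by simp
    then show "\<exists>h. arr \<A> N h W \<and> cmp \<A> h p = g" using h(2) by auto
  qed
qed

text \<open>The structure identity for \<open>g\<close> may be tested after the monic
  \<open>i\<close>. There it turns into the identity for \<open>f\<close>, by naturality of
  \<eta>.\<close>

lemma subobject_\<A>:
  assumes X: "(X, f) \<in> obj \<A>" and i: "monic B J i X" and g: "arr B (fob F J) g J"
    and ig: "i \<cdot> g = f \<cdot> fmor F i"
  shows "(J, g) \<in> obj \<A>" "arr \<A> (J, g) i (X, f)"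
proof -
  note ia = monic_arr[OF i] and Fi = F_arr[OF monic_arr[OF i]]
  have f: "arr B (fob F X) f X" and ff: "f \<cdot> fmor F f = f \<cdot> \<eta> X" using X unfolding obj_\<A> by auto
  have J: "J \<in> obj B" and Xo: "X \<in> obj B" using arr_obj[OF ia] by simp_all
  note eJ = eta_arr[OF J] and eX = eta_arr[OF Xo]
  have "i \<cdot> (g \<cdot> fmor F g) = (f \<cdot> fmor F i) \<cdot> fmor F g" by (rule comp_eq_left[OF F_arr[OF g] g ia ig])
  also have "\<dots> = f \<cdot> fmor F (i \<cdot> g)"
    using comp_assoc[OF F_arr[OF g] Fi f] F_comp[OF g ia] by simp
  also have "\<dots> = (f \<cdot> fmor F f) \<cdot> fmor F (fmor F i)"
    using ig F_comp[OF Fi f] comp_assoc[OF F_arr[OF Fi] F_arr[OF f] f] by simp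
  also have "\<dots> = f \<cdot> (\<eta> X \<cdot> fmor F (fmor F i))" using ff comp_assoc[OF F_arr[OF Fi] eX f] by simp
  also have "\<dots> = (f \<cdot> fmor F i) \<cdot> \<eta> J" using eta_natural[OF ia] comp_assoc[OF eJ Fi f] by simp
  also have "\<dots> = i \<cdot> (g \<cdot> \<eta> J)" using ig comp_assoc[OF eJ g ia] by simp
  finally have "g \<cdot> fmor F g = g \<cdot> \<eta> J"
    by (rule monicD[OF i comp_arr[OF F_arr[OF g] g] comp_arr[OF eJ g]])
  then show o: "(J, g) \<in> obj \<A>" using g unfolding obj_\<A> by simp
  show "arr \<A> (J, g) i (X, f)" using o X ia ig unfolding arr_\<A>_iff by simp
qed

text \<open>The structure map of the kernel is induced by \<open>snd X \<cdot> fmor F k\<close>,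
  which \<alpha> kills.\<close>

lemma ex_kernel_\<A>:
  assumes a: "arr \<A> X \<alpha> Y"
  obtains K k where "arr \<A> K k X" "is_kernel B (fst K) k (fst X) \<alpha> (fst Y)"
proof -
  note a' = arr_\<A>D[OF a]
  obtain K k where K: "is_kernel B K k (fst X) \<alpha> (fst Y)" using kernelE[OF a'(3)] .
  note ka = kernel_arr[OF K]
  note f = obj_\<A>_arr[OF a'(1)] and g = obj_\<A>_arr[OF a'(2)] and Fk = F_arr[OF ka(1)]
  have "\<alpha> \<cdot> (snd X \<cdot> fmor F k) = (snd Y \<cdot> fmor F \<alpha>) \<cdot> fmor F k"
    by (rule comp_eq_left[OF Fk f a'(3,4)])
  also have "\<dots> = snd Y \<cdot> fmor F (zerom B K (fst Y))"
    using comp_assoc[OF Fk F_arr[OF a'(3)] g] F_comp[OF ka(1) a'(3)] ka(3) by simp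
  also have "\<dots> = zerom B (fob F K) (fst Y)"
    using F_zero[OF arr_obj(1)[OF ka(1)] arr_obj(2)[OF a'(3)]] comp_zero_right[OF g arr_obj(1)[OF Fk]]
    by simp
  finally obtain h where h: "arr B (fob F K) h K" "k \<cdot> h = snd X \<cdot> fmor F k"
    using kernel_factor[OF K comp_arr[OF Fk f]] by blast
  have "arr \<A> (K, h) k X" using subobject_\<A>(2)[of "fst X" "snd X", OF _ kernel_monic[OF K] h] a'(1) by simp
  then show thesis using that K by fastforce
qed

text \<open>Because \<open>fmor F p\<close> is a cokernel of \<open>fmor F \<alpha>\<close>, the map
  \<open>p \<cdot> snd Y\<close> induces a structure map \<open>n\<close> on \<open>N\<close>. Its
  identity is verified after precomposing with \<open>fmor F (fmor F p)\<close>, which is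
  epic.\<close>

lemma ex_cokernel_\<A>:
  assumes a: "arr \<A> X \<alpha> Y"
  obtains N p where "arr \<A> Y p N" "is_cokernel B (fst X) \<alpha> (fst Y) p (fst N)"
proof -
  note a' = arr_\<A>D[OF a]
  obtain N p where p: "is_cokernel B (fst X) \<alpha> (fst Y) p N" using cokernelE[OF a'(3)] .
  note pa = cokernel_arr[OF p]
  note f = obj_\<A>_arr[OF a'(1)] and g = obj_\<A>_arr[OF a'(2)] and Fp = F_arr[OF pa(2)]
  have N: "N \<in> obj B" and Y: "fst Y \<in> obj B" using arr_obj[OF pa(2)] by simp_all
  have gg: "snd Y \<cdot> fmor F (snd Y) = snd Y \<cdot> \<eta> (fst Y)" using a'(2) obj_\<A>[of "fst Y" "snd Y"] by simp
  have "(p \<cdot> snd Y) \<cdot> fmor F \<alpha> = p \<cdot> (\<alpha> \<cdot> snd X)"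
    using comp_assoc[OF F_arr[OF a'(3)] g pa(2)] a'(4) by simp
  also have "\<dots> = zerom B (fob F (fst X)) N" by (rule comp_zeroL[OF pa(3) f pa(1,2)])
  finally obtain n where n: "arr B (fob F N) n N" "n \<cdot> fmor F p = p \<cdot> snd Y"
    using cokernel_factor[OF F_cokernel[OF p] comp_arr[OF g pa(2)]] by blast
  note FFp = F_arr[OF Fp] and eN = eta_arr[OF N] and eY = eta_arr[OF Y]
  have "(n \<cdot> fmor F n) \<cdot> fmor F (fmor F p) = n \<cdot> (fmor F p \<cdot> fmor F (snd Y))"
    using comp_assoc[OF FFp F_arr[OF n(1)] n(1)] F_comp[OF Fp n(1)] F_comp[OF g pa(2)] n(2) by simp
  also have "\<dots> = (p \<cdot> snd Y) \<cdot> fmor F (snd Y)" by (rule comp_eq_left[OF F_arr[OF g] Fp n])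
  also have "\<dots> = (p \<cdot> snd Y) \<cdot> \<eta> (fst Y)"
    using comp_assoc[OF F_arr[OF g] g pa(2)] comp_assoc[OF eY g pa(2)] gg by simp
  also have "\<dots> = n \<cdot> (fmor F p \<cdot> \<eta> (fst Y))" using comp_eq_left[OF eY Fp n] by simp
  also have "\<dots> = (n \<cdot> \<eta> N) \<cdot> fmor F (fmor F p)"
    using eta_natural[OF pa(2)] comp_assoc[OF FFp eN n(1)] by simp
  finally have "n \<cdot> fmor F n = n \<cdot> \<eta> N"
    by (rule epicD[OF F_epic[OF F_epic[OF cokernel_epic[OF p]]] comp_arr[OF F_arr[OF n(1)] n(1)]
          comp_arr[OF eN n(1)]])
  then have "(N, n) \<in> obj \<A>" using n(1) unfolding obj_\<A> by simp
  then have "arr \<A> Y p (N, n)" using a'(2) pa(2) n(2) unfolding arr_\<A>_iff by simp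
  then show thesis using that p by fastforce
qed

text \<open>The kernel of \<alpha> in \<open>B\<close> carries an object of \<open>\<A>\<close>, so
  monicity in \<open>\<A>\<close> makes its inclusion zero, and then everything killed by \<alpha>
  in \<open>B\<close> is zero.\<close>

lemma monic_\<A>D:
  assumes m: "monic \<A> X \<alpha> Y"
  shows "monic B (fst X) \<alpha> (fst Y)"
proof -
  interpret A: preadditive_category \<A> by (rule preadditive_\<A>)
  note a = A.monic_arr[OF m]
  obtain K k where k: "arr \<A> K k X" and K: "is_kernel B (fst K) k (fst X) \<alpha> (fst Y)"
    using ex_kernel_\<A>[OF a] .
  have k0: "k = zerom B (fst K) (fst X)"
    using A.monic_zeroD[OF m k] kernel_arr(3)[OF K] by simp
  show ?thesis
  proof (rule monic_zeroI[OF arr_\<A>D(3)[OF a]])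
    fix W z assume z: "arr B W z (fst X)" "\<alpha> \<cdot> z = zerom B W (fst Y)"
    obtain h where h: "arr B W h (fst K)" "k \<cdot> h = z" using kernel_factor[OF K z] .
    then show "z = zerom B W (fst X)" using k0 comp_zero_left[OF h(1) arr_obj(2)[OF z(1)]] by simp
  qed
qed

lemma epic_\<A>D:
  assumes m: "epic \<A> X \<alpha> Y"
  shows "epic B (fst X) \<alpha> (fst Y)"
proof -
  interpret A: preadditive_category \<A> by (rule preadditive_\<A>)
  note a = A.epic_arr[OF m]
  obtain N p where p: "arr \<A> Y p N" and N: "is_cokernel B (fst X) \<alpha> (fst Y) p (fst N)"
    using ex_cokernel_\<A>[OF a] .
  have p0: "p = zerom B (fst Y) (fst N)"
    using A.epic_zeroD[OF m p] cokernel_arr(3)[OF N] by simp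
  show ?thesis
  proof (rule epic_zeroI[OF arr_\<A>D(3)[OF a]])
    fix W z assume z: "arr B (fst Y) z W" "z \<cdot> \<alpha> = zerom B (fst X) W"
    obtain h where h: "arr B (fst N) h W" "h \<cdot> p = z" using cokernel_factor[OF N z] .
    then show "z = zerom B (fst Y) W" using p0 comp_zero_right[OF h(1) arr_obj(1)[OF z(1)]] by simp
  qed
qed

section \<open>Zero objects, biproducts and normality in the \<eta>-extension\<close>

lemma Z_obj_closed:
  assumes X: "X \<in> obj B"
  shows "Z_obj B F X \<in> obj \<A>"
proof -
  have FX: "fob F X \<in> obj B" by (rule fob_closed[OF X])
  note z = zero_arr[OF FX X]
  show ?thesis
    using z comp_zero_left[OF F_arr[OF z] X] comp_zero_left[OF eta_arr[OF X] X]
    unfolding Z_obj_def obj_\<A> by simp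
qed

lemma ex_zero_object_\<A>: "\<exists>Z. zero_object \<A> Z"
proof -
  obtain Z where Z: "zero_object B Z" using ex_zero_object by blast
  then have Zo: "Z \<in> obj B" by (simp add: zero_object_def)
  have fst: "fst (Z_obj B F Z) = Z" by (simp add: Z_obj_def)
  have "(\<exists>!\<alpha>. \<alpha> \<in> mor \<A> X (Z_obj B F Z)) \<and> (\<exists>!\<alpha>. \<alpha> \<in> mor \<A> (Z_obj B F Z) X)"
    if X: "X \<in> obj \<A>" for X
  proof -
    have "\<alpha> = zerom B (fst X) Z" if "\<alpha> \<in> mor \<A> X (Z_obj B F Z)" for \<alpha>
      using zero_objectD(1)[OF Z, of "fst X" \<alpha>] that arr_\<A>D(3)[of X \<alpha> "Z_obj B F Z"] fst
      by (simp add: mor_\<A>_arr[OF X Z_obj_closed[OF Zo]])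
    moreover have "\<alpha> = zerom B Z (fst X)" if "\<alpha> \<in> mor \<A> (Z_obj B F Z) X" for \<alpha>
      using zero_objectD(2)[OF Z, of \<alpha> "fst X"] that arr_\<A>D(3)[of "Z_obj B F Z" \<alpha> X] fst
      by (simp add: mor_\<A>_arr[OF Z_obj_closed[OF Zo] X])
    ultimately show ?thesis
      using zero_arr_\<A>[OF X Z_obj_closed[OF Zo]] zero_arr_\<A>[OF Z_obj_closed[OF Zo] X]
      unfolding arr_def by blast
  qed
  then show ?thesis using Z_obj_closed[OF Zo] unfolding zero_object_def by blast
qed

lemma ex_biproduct_\<A>:
  assumes X: "X \<in> obj \<A>" and Y: "Y \<in> obj \<A>"
  shows "\<exists>S i j p q. biproduct \<A> X Y S i j p q"
proof -
  define f g where "f = snd X" and "g = snd Y"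
  have f: "arr B (fob F (fst X)) f (fst X)" and g: "arr B (fob F (fst Y)) g (fst Y)"
    and ff: "f \<cdot> fmor F f = f \<cdot> \<eta> (fst X)" and gg: "g \<cdot> fmor F g = g \<cdot> \<eta> (fst Y)"
    using X Y obj_\<A>[of "fst X" "snd X"] obj_\<A>[of "fst Y" "snd Y"] by (auto simp: f_def g_def)
  have Xo: "fst X \<in> obj B" and Yo: "fst Y \<in> obj B" using arr_obj[OF f] arr_obj[OF g] by simp_all
  obtain S i j p q where S: "biproduct B (fst X) (fst Y) S i j p q" using ex_biproduct[OF Xo Yo] by blast
  have i: "arr B (fst X) i S" and j: "arr B (fst Y) j S" and p: "arr B S p (fst X)" and q: "arr B S q (fst Y)"
    and pi: "p \<cdot> i = idm B (fst X)" and qj: "q \<cdot> j = idm B (fst Y)"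
    and pj: "p \<cdot> j = zerom B (fst Y) (fst X)" and qi: "q \<cdot> i = zerom B (fst X) (fst Y)"
    and id: "addm B (i \<cdot> p) (j \<cdot> q) = idm B S"
    using S by (auto simp: biproduct_def arr_def)
  have So: "S \<in> obj B" using arr_obj[OF i] by simp
  note Fi = F_arr[OF i] and Fj = F_arr[OF j] and Fp = F_arr[OF p] and Fq = F_arr[OF q]
  \<comment> \<open>The structure map on \<open>S\<close> will be the diagonal one, the sum of the
    transported structure maps of \<open>X\<close> and \<open>Y\<close>.\<close>
  define a b where "a = i \<cdot> (f \<cdot> fmor F p)" and "b = j \<cdot> (g \<cdot> fmor F q)"
  note fp = comp_arr[OF Fp f] and gq = comp_arr[OF Fq g]
  have a: "arr B (fob F S) a S" and b: "arr B (fob F S) b S"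
    unfolding a_def b_def using comp_arr[OF fp i] comp_arr[OF gq j] .
  define s where "s = addm B a b"
  have s: "arr B (fob F S) s S" unfolding s_def by (rule add_arr[OF a b])
  have Fpi: "fmor F p \<cdot> fmor F i = idm B (fob F (fst X))"
    and Fqj: "fmor F q \<cdot> fmor F j = idm B (fob F (fst Y))"
    and Fpj: "fmor F p \<cdot> fmor F j = zerom B (fob F (fst Y)) (fob F (fst X))"
    and Fqi: "fmor F q \<cdot> fmor F i = zerom B (fob F (fst X)) (fob F (fst Y))"
    using F_comp[OF i p] F_comp[OF j q] F_comp[OF j p] F_comp[OF i q] pi qj pj qi
      fmor_id[OF Xo] fmor_id[OF Yo] F_zero[OF Yo Xo] F_zero[OF Xo Yo] by simp_all
  have fpi: "(f \<cdot> fmor F p) \<cdot> fmor F i = f"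
    using comp_eq_right[OF Fi Fp f Fpi] comp_id_right[OF f] by simp
  have gqj: "(g \<cdot> fmor F q) \<cdot> fmor F j = g"
    using comp_eq_right[OF Fj Fq g Fqj] comp_id_right[OF g] by simp
  \<comment> \<open>This and the next three identities make \<open>i\<close>, \<open>j\<close>,
    \<open>p\<close> and \<open>q\<close> morphisms of \<open>\<A>\<close>.\<close>
  have si: "s \<cdot> fmor F i = i \<cdot> f"
    unfolding s_def comp_add_left[OF Fi a b] unfolding a_def b_def
    using comp_eq_right[OF Fi fp i fpi] comp_zeroR[OF comp_zeroR[OF Fqi Fi Fq g] Fi gq j]
      add_zero(1)[OF comp_arr[OF f i]] by simp
  have sj: "s \<cdot> fmor F j = j \<cdot> g"
    unfolding s_def comp_add_left[OF Fj a b] unfolding a_def b_def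
    using comp_eq_right[OF Fj gq j gqj] comp_zeroR[OF comp_zeroR[OF Fpj Fj Fp f] Fj fp i]
      add_zero(2)[OF comp_arr[OF g j]] by simp
  have ps: "p \<cdot> s = f \<cdot> fmor F p"
    unfolding s_def comp_add_right[OF a b p] unfolding a_def b_def
    using comp_eq_left[OF fp i p pi] comp_id_left[OF fp] comp_zeroL[OF pj gq j p]
      add_zero(1)[OF fp] by simp
  have qs: "q \<cdot> s = g \<cdot> fmor F q"
    unfolding s_def comp_add_right[OF a b q] unfolding a_def b_def
    using comp_eq_left[OF gq j q qj] comp_id_left[OF gq] comp_zeroL[OF qi fp i q]
      add_zero(2)[OF gq] by simp
  \<comment> \<open>A morphism into \<open>S\<close> is determined by its components, so associativity of \<open>s\<close> reduces to \<open>f\<close> and \<open>g\<close>.\<close>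
  have decomp: "addm B (i \<cdot> (p \<cdot> z)) (j \<cdot> (q \<cdot> z)) = z" if z: "arr B W z S" for W z
    using comp_add_left[OF z comp_arr[OF p i] comp_arr[OF q j]] id comp_id_left[OF z]
      comp_assoc[OF z p i] comp_assoc[OF z q j] by simp
  have comp: "r \<cdot> (s \<cdot> fmor F s) = r \<cdot> (s \<cdot> \<eta> S)"
    if r: "arr B S r V" and h: "arr B (fob F V) h V" and hh: "h \<cdot> fmor F h = h \<cdot> \<eta> V"
      and rs: "r \<cdot> s = h \<cdot> fmor F r" for r h V
  proof -
    have Vo: "V \<in> obj B" using arr_obj[OF r] by simp
    note Fr = F_arr[OF r]
    have "r \<cdot> (s \<cdot> fmor F s) = (h \<cdot> fmor F r) \<cdot> fmor F s" by (rule comp_eq_left[OF F_arr[OF s] s r rs])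
    also have "\<dots> = h \<cdot> (fmor F h \<cdot> fmor F (fmor F r))"
      using comp_assoc[OF F_arr[OF s] Fr h] F_comp[OF s r] rs F_comp[OF Fr h] by simp
    also have "\<dots> = (h \<cdot> \<eta> V) \<cdot> fmor F (fmor F r)" by (rule comp_eq_left[OF F_arr[OF Fr] F_arr[OF h] h hh])
    also have "\<dots> = h \<cdot> (fmor F r \<cdot> \<eta> S)"
      using comp_assoc[OF F_arr[OF Fr] eta_arr[OF Vo] h] eta_natural[OF r] by simp
    also have "\<dots> = r \<cdot> (s \<cdot> \<eta> S)"
      using comp_assoc[OF eta_arr[OF So] Fr h] comp_eq_left[OF eta_arr[OF So] s r rs] by simp
    finally show ?thesis .
  qed
  have "s \<cdot> fmor F s = addm B (i \<cdot> (p \<cdot> (s \<cdot> fmor F s))) (j \<cdot> (q \<cdot> (s \<cdot> fmor F s)))"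
    by (rule decomp[OF comp_arr[OF F_arr[OF s] s], symmetric])
  also have "\<dots> = s \<cdot> \<eta> S"
    unfolding comp[OF p f ff ps] comp[OF q g gg qs] by (rule decomp[OF comp_arr[OF eta_arr[OF So] s]])
  finally have "s \<cdot> fmor F s = s \<cdot> \<eta> S" .
  then have SA: "(S, s) \<in> obj \<A>" using s unfolding obj_\<A> by simp
  have "arr \<A> X i (S, s)" "arr \<A> Y j (S, s)" "arr \<A> (S, s) p X" "arr \<A> (S, s) q Y"
    using SA X Y i j p q si sj ps qs unfolding arr_\<A>_iff by (simp_all add: f_def g_def)
  then have "biproduct \<A> X Y (S, s) i j p q"
    using pi qj pj qi id unfolding biproduct_def arr_def by simp
  then show ?thesis by blast
qed

text \<open>A monic of \<open>\<A>\<close> is monic in \<open>B\<close>, hence the kernel there of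
  its cokernel. That cokernel lifts to \<open>\<A>\<close>, where the kernel property is reflected;
  epics are treated dually.\<close>

lemma abelian_\<A>: "abelian_category \<A>"
proof -
  interpret A: preadditive_category \<A> by (rule preadditive_\<A>)
  show ?thesis
  proof
    show "\<exists>Z. zero_object \<A> Z" by (rule ex_zero_object_\<A>)
  next
    fix X Y assume "X \<in> obj \<A>" "Y \<in> obj \<A>"
    then show "\<exists>S i j p q. biproduct \<A> X Y S i j p q" by (rule ex_biproduct_\<A>)
  next
    fix X Y \<alpha> assume "X \<in> obj \<A>" "Y \<in> obj \<A>" "\<alpha> \<in> mor \<A> X Y"
    then have a: "arr \<A> X \<alpha> Y" by (simp add: arr_def)
    show "\<exists>K k. is_kernel \<A> K k X \<alpha> Y" using ex_kernel_\<A>[OF a] is_kernel_\<A>I[OF _ a] by metis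
    show "\<exists>N p. is_cokernel \<A> X \<alpha> Y p N" using ex_cokernel_\<A>[OF a] is_cokernel_\<A>I[OF a] by metis
  next
    fix X Y \<alpha> assume m: "monic \<A> X \<alpha> Y"
    note a = A.monic_arr[OF m]
    obtain N p where p: "arr \<A> Y p N" "is_cokernel B (fst X) \<alpha> (fst Y) p (fst N)"
      using ex_cokernel_\<A>[OF a] .
    show "\<exists>Z g. is_kernel \<A> X \<alpha> Y g Z"
      using is_kernel_\<A>I[OF a p(1) monic_kernel_of_cokernel[OF monic_\<A>D[OF m] p(2)]] by blast
  next
    fix X Y \<alpha> assume m: "epic \<A> X \<alpha> Y"
    note a = A.epic_arr[OF m]
    obtain K k where k: "arr \<A> K k X" "is_kernel B (fst K) k (fst X) \<alpha> (fst Y)"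
      using ex_kernel_\<A>[OF a] .
    show "\<exists>W g. is_cokernel \<A> W g X \<alpha> Y"
      using is_cokernel_\<A>I[OF k(1) a epic_cokernel_of_kernel[OF epic_\<A>D[OF m] k(2)]] by blast
  qed
qed

text \<open>One Loewy step: the inclusion \<open>i\<close> of the image has the same cokernel as
  \<open>f\<close>, and since the projection \<open>p\<close> kills \<open>f\<close>, it is a
  morphism onto the cokernel with zero structure map.\<close>

lemma eta_image_short_exact:
  assumes A: "A \<in> obj \<A>"
  shows "eta_image B F A \<in> obj \<A> \<and>
    (\<exists>i p. short_exact \<A> (eta_image B F A) i A p (Z_obj B F (C_obj B F A)))"
proof -
  obtain X f where Xf: "A = (X, f)" by (cases A)
  have f: "arr B (fob F X) f X" using A unfolding Xf obj_\<A> by simp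
  \<comment> \<open>Names the choice made in \<open>eta_image\<close>, so that its components are
    the image factorization used below.\<close>
  define R where "R = (SOME (J, q, i). image_factorization B (fob F X) f X J q i)"
  obtain J q i where R: "R = (J, q, i)" by (cases R)
  have "\<exists>R. case R of (J, q, i) \<Rightarrow> image_factorization B (fob F X) f X J q i"
    using ex_image_factorization[OF f] by auto
  then have "case R of (J, q, i) \<Rightarrow> image_factorization B (fob F X) f X J q i"
    unfolding R_def by (rule someI_ex)
  then have q: "epic B (fob F X) q J" and i: "monic B J i X" and iq: "f = i \<cdot> q"
    using R unfolding image_factorization_def by auto
  have I: "eta_image B F A = (J, q \<cdot> fmor F i)"
    unfolding eta_image_def Xf using R by (simp add: R_def)
  note qa = epic_arr[OF q] and ia = monic_arr[OF i]
  note Fi = F_arr[OF ia]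
  have "i \<cdot> (q \<cdot> fmor F i) = f \<cdot> fmor F i" using comp_assoc[OF Fi qa ia] iq by simp
  note sub = subobject_\<A>[OF A[unfolded Xf] i comp_arr[OF Fi qa] this]
  define N where "N = C_obj B F A"
  have "\<exists>N p. is_cokernel B (fob F X) f X p N" using cokernelE[OF f] by metis
  then have "\<exists>p. is_cokernel B (fob F X) f X p N"
    unfolding N_def C_obj_def Xf prod.case by (rule someI_ex)
  then obtain p where p: "is_cokernel B (fob F X) f X p N" by blast
  note pa = cokernel_arr[OF p]
  have N: "N \<in> obj B" using arr_obj[OF pa(2)] by simp_all
  have "p \<cdot> f = zerom B (fob F N) N \<cdot> fmor F p" using pa(3) comp_zero_left[OF F_arr[OF pa(2)] N] by simp
  then have pA: "arr \<A> (X, f) p (Z_obj B F N)"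
    using A Z_obj_closed[OF N] pa(2) unfolding arr_\<A>_iff Xf by (simp add: Z_obj_def)
  have "is_cokernel B J i X p N" using cokernel_of_image[OF _ q ia] p iq by simp
  then have c: "is_cokernel \<A> (J, q \<cdot> fmor F i) i (X, f) p (Z_obj B F N)"
    using is_cokernel_\<A>I[OF sub(2) pA] by (simp add: Z_obj_def)
  have m: "monic \<A> (J, q \<cdot> fmor F i) i (X, f)" using monic_\<A>I[OF sub(2)] i by simp
  show ?thesis
    using sub(1) abelian_category.short_exactI[OF abelian_\<A> m c] unfolding I N_def[symmetric]
    unfolding Xf by blast
qed

lemma eta_image_pow_obj: "A \<in> obj \<A> \<Longrightarrow> eta_image_pow B F r A \<in> obj \<A>"
  by (induction r) (auto simp: eta_image_pow_def eta_image_short_exact)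

lemma Loewy_short_exact:
  assumes "A \<in> obj \<A>"
  shows "\<exists>i p. short_exact \<A> (eta_image_pow B F (Suc r) A) i (eta_image_pow B F r A) p (Loewy_factor B F r A)"
  using eta_image_short_exact[OF eta_image_pow_obj[OF assms, of r]]
  by (simp add: eta_image_pow_def Loewy_factor_def)

end

section \<open>Approximation along the Loewy filtration\<close>

theorem theorem3p11:
  fixes B :: "('o, 'm) cat"
    and F :: "('o, 'm) endofun"
    and \<eta> :: "'o \<Rightarrow> 'm"
    and \<A> :: "('o \<times> 'm, 'm) cat"
    and \<D> \<Q> :: "('o \<times> 'm) set"
  defines "\<A> \<equiv> eta_extension B F \<eta>"
  assumes "abelian_category B"
    and "enough_projectives B" and "enough_injectives B"
    and "additive_endofunctor B F" and "right_exact B F"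
    and "nat_trans_sq B F \<eta>" and "associative_trans B F \<eta>"
    and "enough_projectives \<A>" and "enough_injectives \<A>"
    and "additive_class \<A> \<D>" and "additive_class \<A> \<Q>"
    and "extension_closed \<A> \<D>" and "extension_closed \<A> \<Q>"
    and "Ext_vanishes \<A> 2 \<Q> \<D>"
  shows "extension_closed \<A> (App \<A> \<D> \<Q>) \<and>
    (\<forall>A\<in>obj \<A>. image_nilpotent B F \<eta> A \<and>
       (\<forall>r<Loewy_length B F \<eta> A. Loewy_factor B F r A \<in> App \<A> \<D> \<Q>) \<longrightarrow>
       A \<in> App \<A> \<D> \<Q>) \<and>
    (\<forall>A\<in>obj \<A>. \<forall>m D\<^sub>0 Q\<^sub>0 u v.
       image_nilpotent B F \<eta> A \<and> Loewy_length B F \<eta> A = m \<and>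
       (\<forall>r<m. D\<^sub>0 r \<in> \<D> \<and> Q\<^sub>0 r \<in> \<Q> \<and>
          short_exact \<A> (Loewy_factor B F r A) (u r) (D\<^sub>0 r) (v r) (Q\<^sub>0 r)) \<longrightarrow>
       (\<exists>D\<^sub>A Q\<^sub>A a b D d Q q. short_exact \<A> A a D\<^sub>A b Q\<^sub>A \<and>
          filtration \<A> m D\<^sub>A D d D\<^sub>0 \<and> filtration \<A> m Q\<^sub>A Q q Q\<^sub>0))"
proof -
  interpret eta_extension_data B F \<eta>
    by (intro eta_extension_data.intro eta_extension_data_axioms.intro assms)
  interpret A: abelian_category \<A> unfolding \<A>_def by (rule abelian_\<A>)
  \<comment> \<open>The filtered statement together with membership in \<open>\<D>\<close> and
    \<open>\<Q>\<close>, so that membership of \<open>A\<close> in \<open>App \<A> \<D> \<Q>\<close>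
    can be read off as well.\<close>
  have main: "\<exists>D\<^sub>A Q\<^sub>A a b D d Q q. D\<^sub>A \<in> \<D> \<and> Q\<^sub>A \<in> \<Q> \<and> short_exact \<A> A a D\<^sub>A b Q\<^sub>A \<and>
      filtration \<A> m D\<^sub>A D d D\<^sub>0 \<and> filtration \<A> m Q\<^sub>A Q q Q\<^sub>0"
    if A: "A \<in> obj \<A>" and nil: "image_nilpotent B F \<eta> A" and m: "Loewy_length B F \<eta> A = m"
      and 0: "\<forall>r<m. D\<^sub>0 r \<in> \<D> \<and> Q\<^sub>0 r \<in> \<Q> \<and>
          short_exact \<A> (Loewy_factor B F r A) (u r) (D\<^sub>0 r) (v r) (Q\<^sub>0 r)"
    for A m D\<^sub>0 Q\<^sub>0 u v
  proof -
    \<comment> \<open>Image-nilpotency makes the set under \<open>LEAST\<close> nonempty, so the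
      minimum is attained.\<close>
    have zero: "zero_object \<A> (eta_image_pow B F m A)"
      using nil LeastI_ex[of "\<lambda>d. zero_object \<A> (eta_image_pow B F d A)"] m
      unfolding image_nilpotent_def Loewy_length_def \<A>_def by simp
    have "\<forall>r. \<exists>i p. short_exact \<A> (eta_image_pow B F (Suc r) A) i (eta_image_pow B F r A) p
        (Loewy_factor B F r A)"
      using Loewy_short_exact[of A] A unfolding \<A>_def by blast
    then obtain i p where step: "\<And>r. short_exact \<A> (eta_image_pow B F (Suc r) A) (i r)
        (eta_image_pow B F r A) (p r) (Loewy_factor B F r A)"
      by metis
    \<comment> \<open>The chain is the sequence of iterated images; its term at index 0 is
      \<open>A\<close> itself.\<close>
    show ?thesis
      using A.ex_approximation_filtration[of \<D> \<Q> "\<lambda>r. eta_image_pow B F r A" m i p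
          "\<lambda>r. Loewy_factor B F r A" u D\<^sub>0 v Q\<^sub>0] assms(9,11-15) zero step 0
      by (simp add: eta_image_pow_def)
  qed
  have nilpotent: "A \<in> App \<A> \<D> \<Q>"
    if A: "A \<in> obj \<A>" and nil: "image_nilpotent B F \<eta> A"
      and fac: "\<forall>r<Loewy_length B F \<eta> A. Loewy_factor B F r A \<in> App \<A> \<D> \<Q>" for A
  proof -
    \<comment> \<open>The bound on \<open>r\<close> is moved inside the existential quantifiers so
      that approximating sequences can be chosen as total functions of \<open>r\<close>.\<close>
    have "\<forall>r. \<exists>D Q u v. r < Loewy_length B F \<eta> A \<longrightarrow>
        D \<in> \<D> \<and> Q \<in> \<Q> \<and> short_exact \<A> (Loewy_factor B F r A) u D v Q"
      using fac unfolding App_def by blast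
    then obtain D\<^sub>0 Q\<^sub>0 u v where "\<forall>r<Loewy_length B F \<eta> A. D\<^sub>0 r \<in> \<D> \<and> Q\<^sub>0 r \<in> \<Q> \<and>
        short_exact \<A> (Loewy_factor B F r A) (u r) (D\<^sub>0 r) (v r) (Q\<^sub>0 r)"
      by metis
    from main[OF A nil refl this] show ?thesis using A unfolding App_def by blast
  qed
  show ?thesis
  proof (intro conjI ballI allI impI)
    show "extension_closed \<A> (App \<A> \<D> \<Q>)"
      by (rule A.extension_closed_App[OF assms(9,13-15)])
  next
    fix A assume "A \<in> obj \<A>" "image_nilpotent B F \<eta> A \<and>
       (\<forall>r<Loewy_length B F \<eta> A. Loewy_factor B F r A \<in> App \<A> \<D> \<Q>)"
    then show "A \<in> App \<A> \<D> \<Q>" by (elim conjE) (rule nilpotent)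
  next
    fix A m D\<^sub>0 Q\<^sub>0 u v assume A: "A \<in> obj \<A>"
      and *: "image_nilpotent B F \<eta> A \<and> Loewy_length B F \<eta> A = m \<and>
       (\<forall>r<m. D\<^sub>0 r \<in> \<D> \<and> Q\<^sub>0 r \<in> \<Q> \<and>
          short_exact \<A> (Loewy_factor B F r A) (u r) (D\<^sub>0 r) (v r) (Q\<^sub>0 r))"
    show "\<exists>D\<^sub>A Q\<^sub>A a b D d Q q. short_exact \<A> A a D\<^sub>A b Q\<^sub>A \<and>
          filtration \<A> m D\<^sub>A D d D\<^sub>0 \<and> filtration \<A> m Q\<^sub>A Q q Q\<^sub>0"
      using main[OF A *[THEN conjunct1] *[THEN conjunct2, THEN conjunct1]
          *[THEN conjunct2, THEN conjunct2]] by blast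
  qed
qed

end
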